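(* There is an absolute constant $c > 0$ such that for every integer $h \geq 2$ there exists $\varepsilon_0(h) > 0$, and for every $0 < \varepsilon < \varepsilon_0(h)$ there exists $n_0(h,\varepsilon)$, such that the following holds for all integers $n > n_0(h,\varepsilon)$: if $A$ is a set of $n$ real numbers with $$|A.A| \leq n^{1+\varepsilon},$$ then $$|h(A.A)| = |A.A + A.A + \cdots + A.A| > n^{c\,(h/\log h)^{1/3}}.$$
   Context: For a finite set $A$ of real numbers, $A.A = \{ab : a,b \in A\}$ is its product set. For a finite set $X$ of reals, $hX = X + \cdots + X$ ($h$ summands) denotes the $h$-fold sumset $\{x_1 + \cdots + x_h : x_i \in X\}$; thus $h(A.A)$ is the $h$-fold sumset of $A.A$. *)

theory Defs
  imports Complex_Main "HOL-Library.Set_Algebras"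
begin

text \<open>
  Arithmetic on sets is the pointwise one of \<^theory>\<open>HOL-Library.Set_Algebras\<close>; in particular
  \<open>A * A\<close> is the product set. It makes sets over a commutative monoid a commutative monoid
  with unit \<open>{0}\<close>, so the sum below is an iterated Minkowski sum.
\<close>

definition hfold_sumset :: "nat \<Rightarrow> 'a::comm_monoid_add set \<Rightarrow> 'a set"
  where "hfold_sumset h X = (\<Sum>i<h. X)"

lemma product_set_eq: "A * A = {a * b | a b. a \<in> A \<and> b \<in> A}"
  for A :: "'a::times set"
  by (auto simp: set_times_def)

lemma hfold_sumset_eq: "hfold_sumset h X = {\<Sum>i<h. x i | x. \<forall>i<h. x i \<in> X}"
  unfolding hfold_sumset_def by (subst set_sum_alt) auto

end

(*
  A popular-sum argument replaces A by a set C of logarithms such that C + C - C - C is not much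
  larger than C and exp(C - C) lies in a dilate of A.A. A pigeonhole over tuples of C, sorted by
  their second differences, produces a step u, small compared with the spacing of a large set B,
  such that b + e u lies in C - C for all b in B and all small e. An integer combination
  sum_i (exp(e_i u) - exp(e'_i u)) whose exponents have equal power sums up to degree s - 1 but
  not s (a Prouhet-Tarry-Escott pair of exact degree) has size about u^s, so sums weighted by
  exp(b) with b in B, one weight for each available s, are pairwise distinct, like digit
  expansions in base u. (If C meets too many unit intervals, there may be no such B in a bounded
  range; then exp(C - C) has a large lacunary subset, whose subset sums suffice.) A p-adic count
  shows that a positive proportion of the degrees s <= k occurs already with 3 k^2 terms on each
  side. So about k^3 summands give |B|^(const * k) sums.
*)

theory Submission
  imports Defs "HOL-Library.FuncSet" "HOL-Computational_Algebra.Polynomial" "HOL-Number_Theory.Cong"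
begin

text \<open>The obstacle is metric: C is known only through its doubling, so a step u found by
  pigeonhole has no reason to be small against the gaps between the weights. With |C| = s^4, the
  scale is fixed as the first dyadic one at which C meets at least s^2 cells. Up to powers of K, the
  s^8 pairs of first term and step then outnumber the s^6 available positions, which yields a u
  shorter than two cells; and a dense part of C still occupies about s^2 cells, so confinement to
  one of fewer than s unit intervals leaves about s weights. The same u serves all degrees at once.
  The exponents in the Prouhet-Tarry-Escott pairs are not bounded explicitly. They determine the
  number D of second differences and hence a loss K^D, with K a constant times a power of
  n^\<epsilon>. Since D depends on k alone, choosing \<open>\<epsilon>\<^sub>0\<close> in terms of h
  absorbs this loss, whatever D is.\<close>

section \<open>Pairs of tuples of exact Prouhet-Tarry-Escott degree\<close>

text \<open>The Vandermonde matrix of the nodes 0, ..., k - 1 is invertible modulo a prime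
  \<open>q\<close> that is at least k. Pairing the moments with the coefficients of a polynomial
  vanishing at every node but i isolates a multiple of \<open>d i\<close>; the multiplier is a
  product of differences of nodes, nonzero modulo q.\<close>

lemma prime_dvd_of_vanishing_moments:
  fixes d :: "nat \<Rightarrow> int" and q :: int
  assumes q: "prime q" "int k \<le> q"
    and mom: "\<And>j. j < k \<Longrightarrow> q dvd (\<Sum>i<k. int i ^ j * d i)"
    and i: "i < k"
  shows "q dvd d i"
proof -
  define g :: "int poly" where "g = (\<Prod>t\<in>{..<k} - {i}. [:- int t, 1:])"
  have "degree g \<le> (\<Sum>t\<in>{..<k} - {i}. degree [:- int t, 1:])"
    unfolding g_def using degree_prod_sum_le[of "{..<k} - {i}" "\<lambda>t. [:- int t, 1:]"] by (simp add: o_def)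
  also have "\<dots> = k - 1" using i by simp
  finally have deg: "degree g < k" using i by linarith
  have pg: "poly g x = (\<Sum>j<k. coeff g j * x ^ j)" for x
    unfolding poly_altdef
    by (rule sum.mono_neutral_left) (use deg in \<open>auto simp: coeff_eq_0\<close>)
  have "(\<Sum>t<k. poly g (int t) * d t) = (\<Sum>t<k. \<Sum>j<k. coeff g j * (int t ^ j * d t))"
    by (simp add: pg sum_distrib_right mult.assoc)
  also have "\<dots> = (\<Sum>j<k. coeff g j * (\<Sum>t<k. int t ^ j * d t))"
    by (subst sum.swap) (simp add: sum_distrib_left)
  also have "q dvd \<dots>" by (rule dvd_sum) (use mom in simp)
  also have "(\<Sum>t<k. poly g (int t) * d t) = (\<Sum>t<k. if t = i then poly g (int i) * d i else 0)"
  proof (intro sum.cong refl)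
    fix t assume "t \<in> {..<k}"
    then show "poly g (int t) * d t = (if t = i then poly g (int i) * d i else 0)"
      by (auto simp: g_def poly_prod intro!: prod_zero)
  qed
  finally have "q dvd poly g (int i) * d i" using i by simp
  moreover have "\<not> q dvd poly g (int i)"
  proof
    assume "q dvd poly g (int i)"
    then have "q dvd (\<Prod>t\<in>{..<k} - {i}. int i - int t)"
      by (simp add: g_def poly_prod)
    then obtain t where t: "t < k" "t \<noteq> i" "q dvd int i - int t"
      using q(1) by (auto simp: prime_dvd_prod_iff)
    then have "q \<le> \<bar>int i - int t\<bar>"
      using dvd_imp_le_int[of "int i - int t" q] by auto
    then show False using t i q(2) by auto
  qed
  ultimately show ?thesis using q(1) prime_dvd_mult_iff by blast
qed

lemma power_add_first_order:
  fixes x y :: int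
  shows "\<exists>r. (x + y) ^ Suc m = x ^ Suc m + int (Suc m) * x ^ m * y + y\<^sup>2 * r"
proof (induction m)
  case (Suc m)
  then obtain r where r: "(x + y) ^ Suc m = x ^ Suc m + int (Suc m) * x ^ m * y + y\<^sup>2 * r"
    by blast
  have "(x + y) ^ Suc (Suc m) = (x + y) * (x + y) ^ Suc m" by simp
  also have "\<dots> = x ^ Suc (Suc m) + int (Suc (Suc m)) * x ^ Suc m * y
      + y\<^sup>2 * (r * (x + y) + int (Suc m) * x ^ m)"
    unfolding r by (simp add: algebra_simps power2_eq_square)
  finally show ?case by blast
qed (auto intro: exI[of _ 0])

text \<open>Hensel lifting in \<open>b\<close>. With e' = e + q^b d, the power sums of exponent m +
  1 differ by (m + 1) q^b times the sum of e^m d, up to multiples of q^(2b). As m + 1 <= k < q is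
  invertible, all moments of \<open>d\<close> vanish modulo q, and the Vandermonde argument supplies
  one more factor q. The prescribed residues keep the nodes distinct and start the
  induction.\<close>

lemma tuple_cong_of_power_sums_cong:
  fixes e e' :: "nat \<Rightarrow> nat"
  assumes q: "prime q" "k < q"
    and res: "\<And>i. i < k \<Longrightarrow> e i mod q = i" "\<And>i. i < k \<Longrightarrow> e' i mod q = i"
    and ps: "\<And>j. j \<in> {1..k} \<Longrightarrow> [(\<Sum>i<k. e i ^ j) = (\<Sum>i<k. e' i ^ j)] (mod q ^ b)"
    and i: "i < k"
  shows "[e i = e' i] (mod q ^ b)"
  using ps i
proof (induction b arbitrary: i)
  case (Suc b)
  show ?case
  proof (cases "b = 0")
    case True
    then show ?thesis using res Suc.prems(2) by (simp add: cong_def)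
  next
    case False
    have IH: "[e i = e' i] (mod q ^ b)" if "i < k" for i
    proof (rule Suc.IH[OF _ that])
      fix j assume "j \<in> {1..k}"
      from Suc.prems(1)[OF this] show "[(\<Sum>i<k. e i ^ j) = (\<Sum>i<k. e' i ^ j)] (mod q ^ b)"
        by (rule cong_dvd_modulus_nat) (simp add: le_imp_power_dvd)
    qed
    define Q where "Q = int q ^ b"
    define d where "d i = (int (e' i) - int (e i)) div Q" for i
    have d: "int (e' i) = int (e i) + Q * d i" if "i < k" for i
    proof -
      have "[int (e' i) = int (e i)] (mod Q)"
        using IH[OF that] unfolding Q_def by (metis cong_int_iff cong_sym of_nat_power)
      then have "Q dvd int (e' i) - int (e i)" by (simp add: cong_iff_dvd_diff)
      then show ?thesis by (simp add: d_def)
    qed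
    have q0: "q > 0" using q by simp
    \<comment> \<open>From b >= 1 the quadratic error q^(2b) is divisible by q^(b + 1); for b = 0
      the residue hypothesis takes over.\<close>
    have QQ: "int q * Q dvd Q\<^sup>2"
      using False unfolding Q_def power2_eq_square
      by (metis dvd_power mult_dvd_mono dvd_refl bot_nat_0.not_eq_extremum)
    have "int q dvd d i" if "i < k" for i
    proof (rule prime_dvd_of_vanishing_moments[OF _ _ _ that])
      show "prime (int q)" "int k \<le> int q" using q by auto
      fix m assume m: "m < k"
      have "[(\<Sum>i<k. int (e' i) ^ Suc m) = (\<Sum>i<k. int (e i) ^ Suc m)] (mod int q * Q)"
      proof -
        have "[(\<Sum>i<k. e' i ^ Suc m) = (\<Sum>i<k. e i ^ Suc m)] (mod q ^ Suc b)"
          using Suc.prems(1)[of "Suc m"] m by (auto intro: cong_sym)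
        then have "[int (\<Sum>i<k. e' i ^ Suc m) = int (\<Sum>i<k. e i ^ Suc m)] (mod int (q ^ Suc b))"
          by (simp only: cong_int_iff)
        then show ?thesis by (simp add: Q_def)
      qed
      then have "int q * Q dvd (\<Sum>i<k. int (e' i) ^ Suc m - int (e i) ^ Suc m)"
        by (simp add: cong_iff_dvd_diff sum_subtractf)
      moreover have "int q * Q dvd
        (\<Sum>i<k. int (e' i) ^ Suc m - int (e i) ^ Suc m - int (Suc m) * int (e i) ^ m * (Q * d i))"
      proof (rule dvd_sum)
        fix i assume "i \<in> {..<k}"
        obtain r where "(int (e i) + Q * d i) ^ Suc m
            = int (e i) ^ Suc m + int (Suc m) * int (e i) ^ m * (Q * d i) + (Q * d i)\<^sup>2 * r"
          using power_add_first_order by blast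
        then have "int (e' i) ^ Suc m - int (e i) ^ Suc m - int (Suc m) * int (e i) ^ m * (Q * d i)
           = Q\<^sup>2 * ((d i)\<^sup>2 * r)"
          using d \<open>i \<in> {..<k}\<close> by (simp add: power_mult_distrib)
        then show "int q * Q dvd int (e' i) ^ Suc m - int (e i) ^ Suc m
            - int (Suc m) * int (e i) ^ m * (Q * d i)"
          using QQ by (metis dvd_mult2)
      qed
      ultimately have "int q * Q dvd (\<Sum>i<k. int (Suc m) * int (e i) ^ m * (Q * d i))"
        unfolding sum_subtractf[of _ "\<lambda>i. int (Suc m) * int (e i) ^ m * (Q * d i)"]
        by (subst (asm) dvd_diff_right_iff) auto
      also have "\<dots> = (int (Suc m) * (\<Sum>i<k. int (e i) ^ m * d i)) * Q"
        by (simp add: sum_distrib_left sum_distrib_right mult_ac)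
      finally have "int q dvd int (Suc m) * (\<Sum>i<k. int (e i) ^ m * d i)"
        using q0 by (simp add: Q_def del: of_nat_Suc)
      moreover have "\<not> int q dvd int (Suc m)"
        using m q by (simp add: nat_dvd_not_less del: of_nat_Suc)
      ultimately have "int q dvd (\<Sum>i<k. int (e i) ^ m * d i)"
        using q by (subst (asm) prime_dvd_mult_iff) auto
      moreover have "[(\<Sum>i<k. int (e i) ^ m * d i) = (\<Sum>i<k. int i ^ m * d i)] (mod int q)"
      proof (intro cong_sum cong_mult cong_pow cong_refl)
        fix i assume "i \<in> {..<k}"
        then have "[e i = i] (mod q)" using res(1)[of i] q by (simp add: cong_def)
        then show "[int (e i) = int i] (mod int q)" by (simp add: cong_int_iff)
      qed
      ultimately show "int q dvd (\<Sum>i<k. int i ^ m * d i)"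
        using cong_dvd_iff by blast
    qed
    then have "int q * Q dvd int (e' i) - int (e i)"
      using d[OF Suc.prems(2)] Suc.prems(2) by (simp add: mult.commute mult_dvd_mono)
    then have "[int (e' i) = int (e i)] (mod int (q ^ Suc b))"
      by (simp add: cong_iff_dvd_diff Q_def)
    then show ?thesis by (simp only: cong_int_iff cong_sym)
  qed
qed auto

lemma prod_power_diff:
  fixes Q :: nat
  shows "(\<Prod>j\<in>{1..k}. Q ^ (k - j)) = Q ^ (k * (k - 1) div 2)"
proof -
  have "(\<Prod>j\<in>{1..k}. Q ^ (k - j)) = Q ^ (\<Sum>j\<in>{1..k}. k - j)"
    by (simp add: power_sum)
  also have "(\<Sum>j\<in>{1..k}. k - j) = (\<Sum>j<k. j)"
    by (rule sum.reindex_bij_witness[of _ "\<lambda>j. k - j" "\<lambda>j. k - j"]) auto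
  also have "2 * (\<Sum>j<k. j) = k * (k - 1)"
  proof (induction k)
    case (Suc k)
    then show ?case by (cases k) auto
  qed simp
  then have "(\<Sum>j<k. j) = k * (k - 1) div 2" by simp
  finally show ?thesis .
qed

text \<open>By lifting, the power sums modulo Q^k determine a tuple with prescribed residues. The
  j-th sum modulo Q^k splits into its residue modulo Q^j and a quotient with at most Q^(k - j)
  values, so forgetting all quotients costs a factor Q^(k(k-1)/2). Up to the factor q^k this leaves
  Q^(k(k+1)/2) tuples. The modulus Q^j is chosen for the j-th sum because scaling a tuple by Q
  multiplies that sum by Q^j.\<close>

lemma power_sum_separated_tuples:
  fixes q k a :: nat
  assumes q: "prime q" "k < q" and k: "k \<ge> 1" and a: "a \<ge> 1"
  defines "Q \<equiv> q ^ a"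
  obtains Z :: "(nat \<Rightarrow> nat) set"
  where "finite Z" "\<And>e i. e \<in> Z \<Longrightarrow> i < k \<Longrightarrow> e i < Q ^ k"
    "\<And>e e'. e \<in> Z \<Longrightarrow> e' \<in> Z \<Longrightarrow>
       (\<And>j. j \<in> {1..k} \<Longrightarrow> [(\<Sum>i<k. e i ^ j) = (\<Sum>i<k. e' i ^ j)] (mod Q ^ j)) \<Longrightarrow> e = e'"
    "Q ^ (k * k) \<le> card Z * Q ^ (k * (k - 1) div 2) * q ^ k"
proof -
  define Z where "Z = (\<Pi>\<^sub>E i\<in>{..<k}. {v. v < Q ^ k \<and> v mod q = i})"
  define p where "p e j = (\<Sum>i<k. e i ^ j)" for e :: "nat \<Rightarrow> nat" and j
  define \<pi> where "\<pi> e = restrict (\<lambda>j. p e j mod Q ^ j) {1..k}" for e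
  define \<rho> where "\<rho> e = restrict (\<lambda>j. (p e j mod Q ^ k) div Q ^ j) {1..k}" for e
  have q0: "q > 0" using q by simp
  then have Q0: "Q > 0" by (simp add: Q_def)
  have Qk: "Q ^ k = q * q ^ (a * k - 1)"
    using a k by (simp add: Q_def power_mult [symmetric] power_Suc [symmetric] del: power_Suc)
  have finZ: "finite Z" unfolding Z_def by (intro finite_PiE) auto
  have inj: "inj_on (\<lambda>e. (\<pi> e, \<rho> e)) Z"
  proof (rule inj_onI)
    fix e e' assume e: "e \<in> Z" "e' \<in> Z" and eq: "(\<pi> e, \<rho> e) = (\<pi> e', \<rho> e')"
    have "[e i = e' i] (mod q ^ (a * k))" if i: "i < k" for i
    proof (rule tuple_cong_of_power_sums_cong[OF q _ _ _ i])
      show "e i mod q = i" "e' i mod q = i" if "i < k" for i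
        using e that unfolding Z_def by (auto dest: PiE_mem)
      fix j assume j: "j \<in> {1..k}"
      have "\<pi> e j = \<pi> e' j" "\<rho> e j = \<rho> e' j" using eq by simp_all
      then have 1: "p e j mod Q ^ j = p e' j mod Q ^ j"
        and 2: "(p e j mod Q ^ k) div Q ^ j = (p e' j mod Q ^ k) div Q ^ j"
        using j by (simp_all add: \<pi>_def \<rho>_def)
      have "Q ^ j dvd Q ^ k" using j by (simp add: le_imp_power_dvd)
      then have 3: "p e j mod Q ^ k mod Q ^ j = p e' j mod Q ^ k mod Q ^ j"
        using 1 by (simp add: mod_mod_cancel)
      have "p e j mod Q ^ k = p e' j mod Q ^ k"
        using div_mult_mod_eq[of "p e j mod Q ^ k" "Q ^ j"] div_mult_mod_eq[of "p e' j mod Q ^ k" "Q ^ j"]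
        unfolding 2 3 by simp
      then show "[(\<Sum>i<k. e i ^ j) = (\<Sum>i<k. e' i ^ j)] (mod q ^ (a * k))"
        by (simp add: cong_def p_def Q_def power_mult)
    qed
    note c = this
    have "e i = e' i" if "i < k" for i
    proof -
      have "e i < Q ^ k" "e' i < Q ^ k" using e that unfolding Z_def by (auto dest: PiE_mem)
      with c[OF that] show ?thesis
        by (simp add: cong_def Q_def power_mult)
    qed
    then show "e = e'"
      using e unfolding Z_def by (intro PiE_ext[of e "{..<k}" _ e']) auto
  qed
  have "card Z \<le> card (\<pi> ` Z \<times> (\<Pi>\<^sub>E j\<in>{1..k}. {..<Q ^ (k - j)}))"
  proof (rule card_inj_on_le[OF inj])
    have "(p e j mod Q ^ k) div Q ^ j < Q ^ (k - j)" if "j \<in> {1..k}" for e j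
    proof -
      have "p e j mod Q ^ k < Q ^ (k - j) * Q ^ j"
        using that Q0 by (simp add: power_add [symmetric])
      then show ?thesis by (simp add: less_mult_imp_div_less)
    qed
    then show "(\<lambda>e. (\<pi> e, \<rho> e)) ` Z \<subseteq> \<pi> ` Z \<times> (\<Pi>\<^sub>E j\<in>{1..k}. {..<Q ^ (k - j)})"
      unfolding \<rho>_def by auto
    show "finite (\<pi> ` Z \<times> (\<Pi>\<^sub>E j\<in>{1..k}. {..<Q ^ (k - j)}))"
      using finZ by (intro finite_cartesian_product finite_PiE) auto
  qed
  then have cZ: "card Z \<le> card (\<pi> ` Z) * Q ^ (k * (k - 1) div 2)"
    by (simp add: card_cartesian_product card_PiE prod_power_diff del: One_nat_def)
  have "card {v. v < Q ^ k \<and> v mod q = i} \<ge> q ^ (a * k - 1)" if "i < k" for i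
  proof -
    have "card ((\<lambda>z. i + q * z) ` {..<q ^ (a * k - 1)}) \<le> card {v. v < Q ^ k \<and> v mod q = i}"
    proof (intro card_mono image_subsetI CollectI conjI)
      fix z assume "z \<in> {..<q ^ (a * k - 1)}"
      then have "Suc z \<le> q ^ (a * k - 1)" by simp
      then have "q * Suc z \<le> Q ^ k" unfolding Qk by (intro mult_le_mono2)
      then show "i + q * z < Q ^ k" using that q by simp
      show "(i + q * z) mod q = i" using that q by simp
    qed auto
    also have "card ((\<lambda>z. i + q * z) ` {..<q ^ (a * k - 1)}) = q ^ (a * k - 1)"
      using q0 by (subst card_image) (auto simp: inj_on_def)
    finally show ?thesis .
  qed
  then have "(\<Prod>i<k. q ^ (a * k - 1)) \<le> (\<Prod>i<k. card {v. v < Q ^ k \<and> v mod q = i})"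
    by (intro prod_mono) simp
  also have "\<dots> = card Z" unfolding Z_def by (simp add: card_PiE)
  finally have "(\<Prod>i<k. q ^ (a * k - 1)) \<le> card Z" .
  then have "(q ^ (a * k - 1)) ^ k \<le> card Z" by simp
  then have "(Q ^ k) ^ k \<le> q ^ k * card Z" unfolding Qk power_mult_distrib by (rule mult_le_mono2)
  also have "\<dots> \<le> q ^ k * (card (\<pi> ` Z) * Q ^ (k * (k - 1) div 2))" by (rule mult_le_mono2[OF cZ])
  finally have low: "Q ^ (k * k) \<le> card (\<pi> ` Z) * Q ^ (k * (k - 1) div 2) * q ^ k"
    by (simp add: power_mult mult_ac)
  \<comment> \<open>A system of representatives for the values of \<open>\<pi>\<close>.\<close>
  obtain Y where Y: "Y \<subseteq> Z" "inj_on \<pi> Y" "\<pi> ` Z = \<pi> ` Y"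
    using subset_image_inj[of "\<pi> ` Z" \<pi> Z] by auto
  show thesis
  proof (rule that[of Y])
    show "finite Y" using Y finZ finite_subset by blast
    show "e i < Q ^ k" if "e \<in> Y" "i < k" for e i
      using Y(1) that unfolding Z_def by (blast dest: PiE_mem)
    show "e = e'" if "e \<in> Y" "e' \<in> Y"
      and c: "\<And>j. j \<in> {1..k} \<Longrightarrow> [(\<Sum>i<k. e i ^ j) = (\<Sum>i<k. e' i ^ j)] (mod Q ^ j)" for e e'
    proof (rule inj_onD[OF Y(2) _ that(1,2)])
      show "\<pi> e = \<pi> e'" unfolding \<pi>_def p_def using c by (intro restrict_ext) (auto simp: cong_def)
    qed
    show "Q ^ (k * k) \<le> card Y * Q ^ (k * (k - 1) div 2) * q ^ k"
      using low card_image[OF Y(2)] by (simp add: Y(3))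
  qed
qed

section \<open>Base-Q expansions of tuples and the count of attainable degrees\<close>

text \<open>Modulo Q^j only the lowest tuple contributes to the j-th power sum. Separation
  identifies it; it is removed, the rest is divided by Q^j, and the induction continues.\<close>

lemma digit_tuples_eq:
  fixes r r' :: "nat \<Rightarrow> nat \<Rightarrow> nat"
  assumes sep: "\<And>e e'. e \<in> Z \<Longrightarrow> e' \<in> Z \<Longrightarrow>
       (\<And>j. j \<in> {1..k} \<Longrightarrow> [(\<Sum>i<k. e i ^ j) = (\<Sum>i<k. e' i ^ j)] (mod Q ^ j)) \<Longrightarrow> e = e'"
    and Q: "(Q::nat) > 0"
    and "\<And>t. t < l \<Longrightarrow> r t \<in> Z" "\<And>t. t < l \<Longrightarrow> r' t \<in> Z"
    and "\<And>j. j \<in> {1..k} \<Longrightarrow>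
      (\<Sum>t<l. \<Sum>i<k. (Q ^ t * r t i) ^ j) = (\<Sum>t<l. \<Sum>i<k. (Q ^ t * r' t i) ^ j)"
    and "t < l"
  shows "r t = r' t"
  using assms(3-)
proof (induction l arbitrary: r r' t)
  case (Suc l)
  have split: "(\<Sum>t<Suc l. \<Sum>i<k. (Q ^ t * r t i) ^ j)
      = (\<Sum>i<k. r 0 i ^ j) + Q ^ j * (\<Sum>t<l. \<Sum>i<k. (Q ^ t * r (Suc t) i) ^ j)" for r j
    by (subst sum.lessThan_Suc_shift) (simp add: sum_distrib_left power_mult_distrib mult_ac)
  have 0: "r 0 = r' 0"
  proof (rule sep)
    show "r 0 \<in> Z" "r' 0 \<in> Z" using Suc.prems(1,2)[of 0] by auto
    fix j assume j: "j \<in> {1..k}"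
    show "[(\<Sum>i<k. r 0 i ^ j) = (\<Sum>i<k. r' 0 i ^ j)] (mod Q ^ j)"
      using arg_cong[OF Suc.prems(3)[OF j, unfolded split], of "\<lambda>x. x mod Q ^ j"]
      by (simp add: cong_def)
  qed
  have "r (Suc t) = r' (Suc t)" if "t < l" for t
  proof (rule Suc.IH[OF _ _ _ that])
    show "r (Suc t) \<in> Z" "r' (Suc t) \<in> Z" if "t < l" for t using Suc.prems(1,2)[of "Suc t"] that by auto
    fix j assume j: "j \<in> {1..k}"
    show "(\<Sum>t<l. \<Sum>i<k. (Q ^ t * r (Suc t) i) ^ j) = (\<Sum>t<l. \<Sum>i<k. (Q ^ t * r' (Suc t) i) ^ j)"
      using Suc.prems(3)[OF j, unfolded split] Q by (simp add: 0)
  qed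
  then show ?case using 0 Suc.prems(4) by (cases t) auto
qed simp

text \<open>A Prouhet-Tarry-Escott pair of degree exactly \<sigma> - 1, indexed by a common set. For
  exponent 0 both sums count the index set, so \<sigma> is positive.\<close>

definition first_power_sum_gap :: "'i set \<Rightarrow> nat \<Rightarrow> ('i \<Rightarrow> nat) \<Rightarrow> ('i \<Rightarrow> nat) \<Rightarrow> bool" where
  "first_power_sum_gap T \<sigma> e e' \<longleftrightarrow>
    (\<forall>j<\<sigma>. (\<Sum>i\<in>T. e i ^ j) = (\<Sum>i\<in>T. e' i ^ j)) \<and> (\<Sum>i\<in>T. e i ^ \<sigma>) \<noteq> (\<Sum>i\<in>T. e' i ^ \<sigma>)"

text \<open>Tuples whose power sums agree at every degree in \<open>S\<close> agree at all degrees
  up to k, since the least disagreement would itself belong to \<open>S\<close>. So the sums at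
  degrees in S separate the l-digit expansions. Comparing powers of Q gives l k(k+1)/2 <= (l + k)
  \<Sum>S. With one digit the overhead k in the entry size Q^(l + k) would dominate; with l = 3k it
  costs only a factor 4/3. Then \<Sum>S >= 3k(k+1)/8, and \<Sum>S <= k |S| finishes.\<close>

lemma many_first_power_sum_gaps:
  fixes k :: nat
  assumes k: "k \<ge> 1"
  defines "T \<equiv> {..<3 * k} \<times> {..<k}"
  obtains S where "S \<subseteq> {1..k}" "3 * (k + 1) \<le> 8 * card S"
    "\<And>\<sigma>. \<sigma> \<in> S \<Longrightarrow> \<exists>e e'. first_power_sum_gap T \<sigma> e e'"
proof -
  define S where "S = {\<sigma> \<in> {1..k}. \<exists>e e'. first_power_sum_gap T \<sigma> e e'}"
  define l where "l = 3 * k"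
  obtain q :: nat where q: "prime q" "k < q" using bigger_prime by blast
  have finS: "finite S" and Sk: "S \<subseteq> {1..k}" by (auto simp: S_def)
  have finT: "finite T" and cT: "card T = l * k" by (auto simp: T_def l_def)
  have bound: "(q ^ a) ^ (k * k * l) \<le>
      (l * k) ^ k * q ^ (k * l) * (q ^ a) ^ ((l + k) * (\<Sum>S) + l * (k * (k - 1) div 2))"
    if a: "a \<ge> 1" for a
  proof -
    define Q where "Q = q ^ a"
    have Q1: "Q \<ge> 1" using q by (simp add: Q_def)
    obtain Z where Z: "finite Z" "\<And>e i. e \<in> Z \<Longrightarrow> i < k \<Longrightarrow> e i < Q ^ k"
      "\<And>e e'. e \<in> Z \<Longrightarrow> e' \<in> Z \<Longrightarrow>
         (\<And>j. j \<in> {1..k} \<Longrightarrow> [(\<Sum>i<k. e i ^ j) = (\<Sum>i<k. e' i ^ j)] (mod Q ^ j)) \<Longrightarrow> e = e'"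
      "Q ^ (k * k) \<le> card Z * Q ^ (k * (k - 1) div 2) * q ^ k"
      by (rule power_sum_separated_tuples[OF q k a, folded Q_def]) blast
    define ex where "ex r = (\<lambda>(t, i). Q ^ t * r t i)" for r :: "nat \<Rightarrow> nat \<Rightarrow> nat"
    have exsum: "(\<Sum>x\<in>T. ex r x ^ j) = (\<Sum>t<l. \<Sum>i<k. (Q ^ t * r t i) ^ j)" for r j
      unfolding T_def ex_def l_def by (simp add: sum.cartesian_product case_prod_unfold)
    define \<Phi> where "\<Phi> r = restrict (\<lambda>\<sigma>. \<Sum>x\<in>T. ex r x ^ \<sigma>) S" for r
    have "inj_on \<Phi> ({..<l} \<rightarrow>\<^sub>E Z)"
    proof (rule inj_onI)
      fix r r' assume r: "r \<in> {..<l} \<rightarrow>\<^sub>E Z" "r' \<in> {..<l} \<rightarrow>\<^sub>E Z" and eq: "\<Phi> r = \<Phi> r'"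
      have all: "(\<Sum>x\<in>T. ex r x ^ j) = (\<Sum>x\<in>T. ex r' x ^ j)" if "j \<le> k" for j
        using that
      proof (induction j rule: less_induct)
        case (less j)
        show ?case
        proof (rule ccontr)
          assume ne: "\<not> ?case"
          then have "j \<noteq> 0" by (cases j) auto
          moreover have "first_power_sum_gap T j (ex r) (ex r')"
            using ne less unfolding first_power_sum_gap_def by simp
          ultimately have "j \<in> S" using less.prems unfolding S_def by force
          then show False using ne fun_cong[OF eq, of j] by (simp add: \<Phi>_def)
        qed
      qed
      have "r t = r' t" if "t < l" for t
      proof (rule digit_tuples_eq[where Q = Q and Z = Z and k = k and l = l])
        show "e = e'" if "e \<in> Z" "e' \<in> Z"
          "\<And>j. j \<in> {1..k} \<Longrightarrow> [(\<Sum>i<k. e i ^ j) = (\<Sum>i<k. e' i ^ j)] (mod Q ^ j)" for e e'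
          using that by (rule Z(3))
        show "(\<Sum>t<l. \<Sum>i<k. (Q ^ t * r t i) ^ j) = (\<Sum>t<l. \<Sum>i<k. (Q ^ t * r' t i) ^ j)"
          if "j \<in> {1..k}" for j using all[of j] that by (simp add: exsum)
      qed (use Q1 r that in \<open>auto dest: PiE_mem\<close>)
      then show "r = r'" using r by (intro PiE_ext[of r "{..<l}" _ r']) auto
    qed
    moreover have "\<Phi> ` ({..<l} \<rightarrow>\<^sub>E Z) \<subseteq> (\<Pi>\<^sub>E \<sigma>\<in>S. {..<(l * k) * Q ^ ((l + k) * \<sigma>)})"
    proof (intro image_subsetI)
      fix r assume r: "r \<in> {..<l} \<rightarrow>\<^sub>E Z"
      have lt: "ex r x < Q ^ (l + k)" if "x \<in> T" for x
      proof -
        obtain t i where x: "x = (t, i)" by force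
        then have ti: "t < l" "i < k" using that by (auto simp: T_def l_def)
        then have "r t i < Q ^ k" using Z(2)[of "r t" i] r by (auto dest: PiE_mem)
        then have "Q ^ t * r t i < Q ^ t * Q ^ k" using Q1 by simp
        also have "\<dots> \<le> Q ^ (l + k)" using Q1 ti
          by (simp add: power_add [symmetric] power_increasing)
        finally show ?thesis by (simp add: ex_def x)
      qed
      have "(\<Sum>x\<in>T. ex r x ^ \<sigma>) < l * k * Q ^ ((l + k) * \<sigma>)" if "\<sigma> \<in> S" for \<sigma>
      proof -
        have "(\<Sum>x\<in>T. ex r x ^ \<sigma>) < (\<Sum>x\<in>T. (Q ^ (l + k)) ^ \<sigma>)"
          using that Sk lt finT k
          by (intro sum_strict_mono power_strict_mono) (auto simp: T_def lessThan_empty_iff)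
        then show ?thesis using cT by (simp add: power_mult)
      qed
      then show "\<Phi> r \<in> (\<Pi>\<^sub>E \<sigma>\<in>S. {..<(l * k) * Q ^ ((l + k) * \<sigma>)})"
        unfolding \<Phi>_def by auto
    qed
    moreover have "finite (\<Pi>\<^sub>E \<sigma>\<in>S. {..<(l * k) * Q ^ ((l + k) * \<sigma>)})"
      using finS by (intro finite_PiE) auto
    ultimately have "card ({..<l} \<rightarrow>\<^sub>E Z) \<le> card (\<Pi>\<^sub>E \<sigma>\<in>S. {..<(l * k) * Q ^ ((l + k) * \<sigma>)})"
      by (rule card_inj_on_le)
    then have "card Z ^ l \<le> (l * k) ^ card S * Q ^ ((l + k) * \<Sum>S)"
      using finS Z(1) by (simp add: card_PiE prod.distrib power_sum [symmetric] sum_distrib_left)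
    also have "\<dots> \<le> (l * k) ^ k * Q ^ ((l + k) * \<Sum>S)"
      using k card_mono[OF _ Sk] by (intro mult_le_mono1 power_increasing) (auto simp: l_def)
    finally have cZ: "card Z ^ l \<le> (l * k) ^ k * Q ^ ((l + k) * \<Sum>S)" .
    have "Q ^ (k * k * l) = (Q ^ (k * k)) ^ l" by (simp add: power_mult)
    also have "\<dots> \<le> (card Z * Q ^ (k * (k - 1) div 2) * q ^ k) ^ l"
      using Z(4) by (rule power_mono) simp
    also have "\<dots> = card Z ^ l * (Q ^ (l * (k * (k - 1) div 2)) * q ^ (k * l))"
      by (simp add: power_mult_distrib power_mult [symmetric] mult_ac)
    also have "\<dots> \<le> (l * k) ^ k * Q ^ ((l + k) * \<Sum>S) * (Q ^ (l * (k * (k - 1) div 2)) * q ^ (k * l))"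
      by (rule mult_le_mono1[OF cZ])
    also have "\<dots> = (l * k) ^ k * q ^ (k * l) * Q ^ ((l + k) * (\<Sum>S) + l * (k * (k - 1) div 2))"
      by (simp add: power_add mult_ac)
    finally show ?thesis by (simp add: Q_def)
  qed
  \<comment> \<open>The prefactor c does not depend on a, and a = c + 1 already makes Q exceed it,
    so the exponents of Q themselves must compare.\<close>
  have main: "k * k * l \<le> (l + k) * (\<Sum>S) + l * (k * (k - 1) div 2)" (is "?L \<le> ?R")
  proof (rule ccontr)
    assume "\<not> ?L \<le> ?R"
    define c where "c = (l * k) ^ k * q ^ (k * l)"
    define Q where "Q = q ^ Suc c"
    have "q \<ge> 2" using q prime_ge_2_nat by blast
    have "c < 2 ^ c" by (rule less_exp)
    also have "\<dots> \<le> q ^ c" using \<open>q \<ge> 2\<close> by (rule power_mono) simp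
    also have "\<dots> \<le> Q" unfolding Q_def using \<open>q \<ge> 2\<close> by (intro power_increasing) auto
    finally have "c < Q" .
    have "Q * Q ^ ?R \<le> Q ^ ?L"
      using \<open>\<not> ?L \<le> ?R\<close> \<open>c < Q\<close> power_increasing[of "Suc ?R" ?L Q] by simp
    also have "\<dots> \<le> c * Q ^ ?R"
      using bound[of "Suc c"] unfolding c_def [symmetric] Q_def [symmetric] by simp
    finally show False using \<open>c < Q\<close> by simp
  qed
  have "even (k * (k - 1))" by (cases k) auto
  then have X: "2 * (k * (k - 1) div 2) = k * (k - 1)" by simp
  have "2 * (k * k * l) \<le> 2 * ((l + k) * (\<Sum>S)) + l * (2 * (k * (k - 1) div 2))"
    using mult_le_mono2[OF main, of 2] by (simp only: distrib_left mult.left_commute)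
  then have "2 * (3 * (k * k * k)) \<le> 8 * (k * (\<Sum>S)) + 3 * k * (k * (k - 1))"
    unfolding X by (simp add: l_def algebra_simps)
  then have "k * (3 * k * k + 3 * k) \<le> k * (8 * \<Sum>S)"
    using k by (cases k) (auto simp: algebra_simps)
  then have "3 * k * k + 3 * k \<le> 8 * \<Sum>S" using k by simp
  also have "\<Sum>S \<le> (\<Sum>\<sigma>\<in>S. k)" using Sk by (intro sum_mono) auto
  finally have "k * (3 * (k + 1)) \<le> k * (8 * card S)" by (simp add: algebra_simps)
  then have S: "3 * (k + 1) \<le> 8 * card S" using k by simp
  show thesis
  proof (rule that[OF Sk S])
    show "\<exists>e e'. first_power_sum_gap T \<sigma> e e'" if "\<sigma> \<in> S" for \<sigma>
      using that unfolding S_def by blast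
  qed
qed

section \<open>Exponential sums near zero\<close>

lemma exp_taylor_remainder:
  fixes c u :: real
  assumes u: "\<bar>u\<bar> \<le> 1"
  shows "\<bar>exp (c * u) - (\<Sum>j<n. (c * u) ^ j / fact j)\<bar> \<le> exp \<bar>c\<bar> * \<bar>c\<bar> ^ n * \<bar>u\<bar> ^ n"
proof -
  obtain t where t: "\<bar>t\<bar> \<le> \<bar>c * u\<bar>"
      "exp (c * u) = (\<Sum>j<n. (c * u) ^ j / fact j) + exp t / fact n * (c * u) ^ n"
    using Maclaurin_exp_le[of "c * u" n] by blast
  have "\<bar>c * u\<bar> \<le> \<bar>c\<bar>" using u by (simp add: abs_mult mult_left_le)
  then have "exp t \<le> exp \<bar>c\<bar>" using t(1) by simp
  moreover have "exp t / fact n \<le> exp t / 1"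
    by (intro divide_left_mono) (auto simp: fact_ge_1)
  ultimately have "exp t / fact n \<le> exp \<bar>c\<bar>" by linarith
  then have "exp t / fact n * \<bar>c * u\<bar> ^ n \<le> exp \<bar>c\<bar> * \<bar>c * u\<bar> ^ n"
    by (rule mult_right_mono) simp
  then show ?thesis
    unfolding t(2) by (simp add: abs_mult power_mult_distrib power_abs mult.assoc)
qed

definition exp_gap :: "'i set \<Rightarrow> ('i \<Rightarrow> nat) \<Rightarrow> ('i \<Rightarrow> nat) \<Rightarrow> real \<Rightarrow> real" where
  "exp_gap T e e' u = (\<Sum>i\<in>T. exp (real (e i) * u)) - (\<Sum>i\<in>T. exp (real (e' i) * u))"

text \<open>The Taylor coefficient of degree j of \<open>exp_gap\<close> is the difference of the
  j-th power sums over j!. Those below \<sigma> cancel and the next does not. A single constant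
  serves as radius, lower factor and reciprocal of the upper factor, so that several degrees are
  handled by one minimum.\<close>

lemma exp_gap_order_bounds:
  assumes gap: "first_power_sum_gap T \<sigma> e e'"
  obtains c where "c > 0" "\<And>u. \<bar>u\<bar> \<le> c \<Longrightarrow> c * \<bar>u\<bar> ^ \<sigma> \<le> \<bar>exp_gap T e e' u\<bar>"
    "\<And>u. \<bar>u\<bar> \<le> c \<Longrightarrow> \<bar>exp_gap T e e' u\<bar> \<le> \<bar>u\<bar> ^ \<sigma> / c"
proof -
  define B where "B e = (\<Sum>i\<in>T. exp (real (e i)) * real (e i) ^ Suc \<sigma>)" for e :: "'a \<Rightarrow> nat"
  define p where "p e u = (\<Sum>j<Suc \<sigma>. (\<Sum>i\<in>T. real (e i) ^ j) * u ^ j / fact j)"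
    for e :: "'a \<Rightarrow> nat" and u :: real
  have approx: "\<bar>(\<Sum>i\<in>T. exp (real (e i) * u)) - p e u\<bar> \<le> B e * \<bar>u\<bar> ^ Suc \<sigma>"
    if u: "\<bar>u\<bar> \<le> 1" for e u
  proof -
    have "p e u = (\<Sum>i\<in>T. \<Sum>j<Suc \<sigma>. (real (e i) * u) ^ j / fact j)"
      unfolding p_def
      by (subst sum.swap) (simp add: sum_distrib_right sum_divide_distrib power_mult_distrib del: sum.lessThan_Suc)
    then have "\<bar>(\<Sum>i\<in>T. exp (real (e i) * u)) - p e u\<bar>
        = \<bar>\<Sum>i\<in>T. exp (real (e i) * u) - (\<Sum>j<Suc \<sigma>. (real (e i) * u) ^ j / fact j)\<bar>"
      by (simp add: sum_subtractf del: sum.lessThan_Suc)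
    also have "\<dots> \<le> (\<Sum>i\<in>T. exp \<bar>real (e i)\<bar> * \<bar>real (e i)\<bar> ^ Suc \<sigma> * \<bar>u\<bar> ^ Suc \<sigma>)"
      by (rule order_trans[OF sum_abs]) (intro sum_mono exp_taylor_remainder u)
    also have "\<dots> = B e * \<bar>u\<bar> ^ Suc \<sigma>" by (simp add: B_def sum_distrib_right)
    finally show ?thesis .
  qed
  define c0 where
    "c0 = ((\<Sum>i\<in>T. real (e i) ^ \<sigma>) - (\<Sum>i\<in>T. real (e' i) ^ \<sigma>)) / fact \<sigma>"
  have real_sum: "(\<Sum>i\<in>T. real (e i) ^ j) = real (\<Sum>i\<in>T. e i ^ j)" for e :: "'a \<Rightarrow> nat" and j by simp
  have c0: "c0 \<noteq> 0"
    using gap unfolding c0_def first_power_sum_gap_def real_sum by (simp del: of_nat_sum)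
  have pdiff: "p e u - p e' u = c0 * u ^ \<sigma>" for u
  proof -
    have "(\<Sum>j<\<sigma>. (\<Sum>i\<in>T. real (e i) ^ j) * u ^ j / fact j)
        = (\<Sum>j<\<sigma>. (\<Sum>i\<in>T. real (e' i) ^ j) * u ^ j / fact j)"
      using gap unfolding first_power_sum_gap_def real_sum by (intro sum.cong) (auto simp del: of_nat_sum)
    then show ?thesis by (simp add: p_def c0_def diff_divide_distrib algebra_simps)
  qed
  define G where "G = B e + B e' + 1"
  have G: "G > 0" unfolding G_def B_def by (intro add_nonneg_pos add_nonneg_nonneg sum_nonneg) auto
  have est: "\<bar>exp_gap T e e' u - c0 * u ^ \<sigma>\<bar> \<le> G * \<bar>u\<bar> * \<bar>u\<bar> ^ \<sigma>" if u: "\<bar>u\<bar> \<le> 1" for u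
  proof -
    have "\<bar>exp_gap T e e' u - c0 * u ^ \<sigma>\<bar> \<le> B e * \<bar>u\<bar> ^ Suc \<sigma> + B e' * \<bar>u\<bar> ^ Suc \<sigma>"
      using approx[OF u, of e] approx[OF u, of e'] unfolding pdiff [symmetric] exp_gap_def by linarith
    also have "\<dots> \<le> G * \<bar>u\<bar> ^ Suc \<sigma>" by (simp add: G_def algebra_simps)
    finally show ?thesis by (simp add: mult_ac)
  qed
  \<comment> \<open>In order: 1 for the Taylor remainder, |c0|/(2G) to keep the error below half the
    leading term, |c0|/2 for the lower bound, 1/(|c0| + G) for the upper bound.\<close>
  define c where "c = min (min 1 (\<bar>c0\<bar> / (2 * G))) (min (\<bar>c0\<bar> / 2) (1 / (\<bar>c0\<bar> + G)))"
  have c: "c > 0" using c0 G by (auto simp: c_def intro!: divide_pos_pos add_nonneg_pos)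
  show thesis
  proof (rule that[OF c])
    fix u :: real assume u: "\<bar>u\<bar> \<le> c"
    then have u1: "\<bar>u\<bar> \<le> 1" and u2: "\<bar>u\<bar> \<le> \<bar>c0\<bar> / (2 * G)" unfolding c_def by auto
    have "G * \<bar>u\<bar> \<le> \<bar>c0\<bar> / 2" using u2 G by (simp add: field_simps)
    then have 1: "G * \<bar>u\<bar> * \<bar>u\<bar> ^ \<sigma> \<le> \<bar>c0\<bar> / 2 * \<bar>u\<bar> ^ \<sigma>" by (rule mult_right_mono) simp
    have abs: "\<bar>c0 * u ^ \<sigma>\<bar> = \<bar>c0\<bar> * \<bar>u\<bar> ^ \<sigma>" by (simp add: abs_mult power_abs)
    have "c * \<bar>u\<bar> ^ \<sigma> \<le> \<bar>c0\<bar> / 2 * \<bar>u\<bar> ^ \<sigma>" by (intro mult_right_mono) (auto simp: c_def)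
    then show "c * \<bar>u\<bar> ^ \<sigma> \<le> \<bar>exp_gap T e e' u\<bar>" using 1 est[OF u1] abs by linarith
    have "\<bar>exp_gap T e e' u\<bar> \<le> \<bar>c0\<bar> * \<bar>u\<bar> ^ \<sigma> + G * \<bar>u\<bar> * \<bar>u\<bar> ^ \<sigma>" using est[OF u1] abs by linarith
    also have "\<dots> = (\<bar>c0\<bar> + G * \<bar>u\<bar>) * \<bar>u\<bar> ^ \<sigma>" by (simp add: algebra_simps)
    also have "\<dots> \<le> (\<bar>c0\<bar> + G) * \<bar>u\<bar> ^ \<sigma>"
      using u1 G by (intro mult_right_mono) (auto simp: mult_left_le)
    also have "\<dots> \<le> 1 / c * \<bar>u\<bar> ^ \<sigma>"
    proof (rule mult_right_mono)
      have "c \<le> 1 / (\<bar>c0\<bar> + G)" by (simp add: c_def)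
      moreover have "\<bar>c0\<bar> + G > 0" using G by simp
      ultimately show "\<bar>c0\<bar> + G \<le> 1 / c" using c by (simp add: field_simps)
    qed simp
    finally show "\<bar>exp_gap T e e' u\<bar> \<le> \<bar>u\<bar> ^ \<sigma> / c" by simp
  qed
qed

text \<open>A degree above \<sigma> gains at least one factor |u|. In \<open>M\<close> = |S| /
  \<eta>^2 one factor 1/\<eta> comes from the upper bounds of the tail and one from the lower bound
  at \<sigma>.\<close>

lemma exp_gap_dominates_tail:
  assumes S: "finite S" and gap: "\<And>\<sigma>. \<sigma> \<in> S \<Longrightarrow> first_power_sum_gap T \<sigma> (e \<sigma>) (e' \<sigma>)"
  obtains \<eta> M :: real where "\<eta> > 0" "M \<ge> 0"
    "\<And>u \<sigma>. 0 < \<bar>u\<bar> \<Longrightarrow> \<bar>u\<bar> < \<eta> \<Longrightarrow> \<sigma> \<in> S \<Longrightarrow> exp_gap T (e \<sigma>) (e' \<sigma>) u \<noteq> 0"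
    "\<And>u \<sigma>. 0 < \<bar>u\<bar> \<Longrightarrow> \<bar>u\<bar> < \<eta> \<Longrightarrow> \<sigma> \<in> S \<Longrightarrow>
      (\<Sum>\<tau> | \<tau> \<in> S \<and> \<sigma> < \<tau>. \<bar>exp_gap T (e \<tau>) (e' \<tau>) u\<bar>) \<le> M * \<bar>u\<bar> * \<bar>exp_gap T (e \<sigma>) (e' \<sigma>) u\<bar>"
proof -
  define F where "F \<sigma> = exp_gap T (e \<sigma>) (e' \<sigma>)" for \<sigma>
  have "\<exists>c>0. \<forall>u. \<bar>u\<bar> \<le> c \<longrightarrow> c * \<bar>u\<bar> ^ \<sigma> \<le> \<bar>F \<sigma> u\<bar> \<and> \<bar>F \<sigma> u\<bar> \<le> \<bar>u\<bar> ^ \<sigma> / c" if "\<sigma> \<in> S" for \<sigma>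
    using exp_gap_order_bounds[OF gap[OF that]] unfolding F_def by metis
  then obtain c where c: "\<And>\<sigma>. \<sigma> \<in> S \<Longrightarrow> c \<sigma> > 0"
    and cl: "\<And>\<sigma> u. \<sigma> \<in> S \<Longrightarrow> \<bar>u\<bar> \<le> c \<sigma> \<Longrightarrow> c \<sigma> * \<bar>u\<bar> ^ \<sigma> \<le> \<bar>F \<sigma> u\<bar>"
    and cu: "\<And>\<sigma> u. \<sigma> \<in> S \<Longrightarrow> \<bar>u\<bar> \<le> c \<sigma> \<Longrightarrow> \<bar>F \<sigma> u\<bar> \<le> \<bar>u\<bar> ^ \<sigma> / c \<sigma>"
    by metis
  define \<eta> where "\<eta> = Min (insert 1 (c ` S))"
  have \<eta>: "\<eta> > 0" "\<eta> \<le> 1" "\<And>\<sigma>. \<sigma> \<in> S \<Longrightarrow> \<eta> \<le> c \<sigma>" using S c by (auto simp: \<eta>_def)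
  have low: "\<eta> * \<bar>u\<bar> ^ \<sigma> \<le> \<bar>F \<sigma> u\<bar>" if "\<sigma> \<in> S" "\<bar>u\<bar> < \<eta>" for \<sigma> u
  proof -
    have "\<eta> * \<bar>u\<bar> ^ \<sigma> \<le> c \<sigma> * \<bar>u\<bar> ^ \<sigma>" using \<eta>(3)[OF that(1)] by (intro mult_right_mono) auto
    then show ?thesis using cl[OF that(1), of u] \<eta>(3)[OF that(1)] that(2) by linarith
  qed
  have up: "\<bar>F \<sigma> u\<bar> \<le> \<bar>u\<bar> ^ \<sigma> / \<eta>" if "\<sigma> \<in> S" "\<bar>u\<bar> < \<eta>" for \<sigma> u
  proof -
    have "\<bar>u\<bar> ^ \<sigma> / c \<sigma> \<le> \<bar>u\<bar> ^ \<sigma> / \<eta>"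
      using \<eta> that c by (intro divide_left_mono mult_pos_pos) auto
    then show ?thesis using cu[OF that(1), of u] \<eta>(3)[OF that(1)] that(2) by linarith
  qed
  show thesis
  proof (rule that[of \<eta> "card S / \<eta>\<^sup>2"])
    fix u \<sigma> assume u: "0 < \<bar>u\<bar>" "\<bar>u\<bar> < \<eta>" and \<sigma>: "\<sigma> \<in> S"
    have pos: "0 < \<eta> * \<bar>u\<bar> ^ \<sigma>" using \<eta> u by simp
    then show "exp_gap T (e \<sigma>) (e' \<sigma>) u \<noteq> 0" using low[OF \<sigma> u(2)] unfolding F_def by auto
    have "(\<Sum>\<tau> | \<tau> \<in> S \<and> \<sigma> < \<tau>. \<bar>F \<tau> u\<bar>) \<le> (\<Sum>\<tau> | \<tau> \<in> S \<and> \<sigma> < \<tau>. \<bar>u\<bar> ^ Suc \<sigma> / \<eta>)"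
    proof (rule sum_mono)
      fix \<tau> assume \<tau>: "\<tau> \<in> {\<tau> \<in> S. \<sigma> < \<tau>}"
      then have "\<bar>u\<bar> ^ \<tau> \<le> \<bar>u\<bar> ^ Suc \<sigma>" using u \<eta>(2) by (intro power_decreasing) auto
      then show "\<bar>F \<tau> u\<bar> \<le> \<bar>u\<bar> ^ Suc \<sigma> / \<eta>"
        using up[of \<tau> u] \<tau> u \<eta>(1) by (auto simp: field_simps)
    qed
    also have "\<dots> \<le> card S * (\<bar>u\<bar> ^ Suc \<sigma> / \<eta>)"
      unfolding sum_constant using S \<eta>(1)
      by (intro mult_right_mono of_nat_mono card_mono divide_nonneg_pos) auto
    also have "\<dots> = card S / \<eta>\<^sup>2 * \<bar>u\<bar> * (\<eta> * \<bar>u\<bar> ^ \<sigma>)"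
      using \<eta>(1) by (simp add: power2_eq_square)
    also have "\<dots> \<le> card S / \<eta>\<^sup>2 * \<bar>u\<bar> * \<bar>F \<sigma> u\<bar>"
      using low[OF \<sigma> u(2)] by (intro mult_left_mono) auto
    finally show "(\<Sum>\<tau> | \<tau> \<in> S \<and> \<sigma> < \<tau>. \<bar>exp_gap T (e \<tau>) (e' \<tau>) u\<bar>)
        \<le> card S / \<eta>\<^sup>2 * \<bar>u\<bar> * \<bar>exp_gap T (e \<sigma>) (e' \<sigma>) u\<bar>"
      unfolding F_def .
  qed (use \<eta> in auto)
qed

section \<open>Digit expansions with real weights, and iterated sumsets\<close>

text \<open>At the least index \<sigma> where two coefficient vectors differ, the term exceeds d L
  |F \<sigma>| in absolute value, while the later terms together contribute at most d times the
  tail. In the application \<open>L\<close> is M |u|, so the weights only need gaps proportional to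
  |u|.\<close>

lemma inj_on_graded_sum:
  fixes F :: "nat \<Rightarrow> real" and A :: "real set"
  assumes S: "finite S"
    and diam: "\<And>a b. a \<in> A \<Longrightarrow> b \<in> A \<Longrightarrow> \<bar>a - b\<bar> \<le> d"
    and sep: "\<And>a b. a \<in> A \<Longrightarrow> b \<in> A \<Longrightarrow> a \<noteq> b \<Longrightarrow> \<bar>a - b\<bar> > d * L"
    and nz: "\<And>\<sigma>. \<sigma> \<in> S \<Longrightarrow> F \<sigma> \<noteq> 0"
    and tail: "\<And>\<sigma>. \<sigma> \<in> S \<Longrightarrow> (\<Sum>\<tau> | \<tau> \<in> S \<and> \<sigma> < \<tau>. \<bar>F \<tau>\<bar>) \<le> L * \<bar>F \<sigma>\<bar>"
  shows "inj_on (\<lambda>a. \<Sum>\<sigma>\<in>S. a \<sigma> * F \<sigma>) (S \<rightarrow>\<^sub>E A)"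
proof (rule inj_onI, rule ccontr)
  fix a b assume a: "a \<in> S \<rightarrow>\<^sub>E A" and b: "b \<in> S \<rightarrow>\<^sub>E A" and "a \<noteq> b"
    and eq: "(\<Sum>\<sigma>\<in>S. a \<sigma> * F \<sigma>) = (\<Sum>\<sigma>\<in>S. b \<sigma> * F \<sigma>)"
  define E where "E = {\<sigma> \<in> S. a \<sigma> \<noteq> b \<sigma>}"
  have "E \<noteq> {}" using \<open>a \<noteq> b\<close> PiE_ext[OF a b] unfolding E_def by blast
  moreover have "finite E" using S by (simp add: E_def)
  ultimately have ME: "Min E \<in> E" "\<And>\<tau>. \<tau> \<in> E \<Longrightarrow> Min E \<le> \<tau>" by auto
  define \<sigma> where "\<sigma> = Min E"
  have \<sigma>: "\<sigma> \<in> S" "a \<sigma> \<noteq> b \<sigma>" using ME(1) by (auto simp: E_def \<sigma>_def)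
  have below: "a \<tau> = b \<tau>" if "\<tau> \<in> S" "\<tau> < \<sigma>" for \<tau>
    using ME(2)[of \<tau>] that by (auto simp: E_def \<sigma>_def)
  have mem: "a \<tau> \<in> A" "b \<tau> \<in> A" if "\<tau> \<in> S" for \<tau> using a b that by auto
  let ?U = "{\<tau> \<in> S. \<sigma> < \<tau>}"
  have "0 = (\<Sum>\<tau>\<in>S. (a \<tau> - b \<tau>) * F \<tau>)" using eq by (simp add: sum_subtractf algebra_simps)
  also have "\<dots> = (\<Sum>\<tau>\<in>insert \<sigma> ?U. (a \<tau> - b \<tau>) * F \<tau>)"
    using S below \<sigma> by (intro sum.mono_neutral_right) (auto, metis linorder_neqE_nat)
  also have "\<dots> = (a \<sigma> - b \<sigma>) * F \<sigma> + (\<Sum>\<tau>\<in>?U. (a \<tau> - b \<tau>) * F \<tau>)" using S by simp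
  finally have "\<bar>a \<sigma> - b \<sigma>\<bar> * \<bar>F \<sigma>\<bar> = \<bar>\<Sum>\<tau>\<in>?U. (a \<tau> - b \<tau>) * F \<tau>\<bar>"
    unfolding abs_mult [symmetric] by linarith
  also have "\<dots> \<le> (\<Sum>\<tau>\<in>?U. d * \<bar>F \<tau>\<bar>)"
  proof (rule order_trans[OF sum_abs], rule sum_mono)
    fix \<tau> assume "\<tau> \<in> ?U"
    then show "\<bar>(a \<tau> - b \<tau>) * F \<tau>\<bar> \<le> d * \<bar>F \<tau>\<bar>"
      unfolding abs_mult using diam mem by (intro mult_right_mono) auto
  qed
  also have "\<dots> \<le> d * (L * \<bar>F \<sigma>\<bar>)"
    unfolding sum_distrib_left [symmetric]
    using tail[OF \<sigma>(1)] diam[OF mem[OF \<sigma>(1)]] by (intro mult_left_mono) auto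
  finally have "\<bar>a \<sigma> - b \<sigma>\<bar> \<le> d * L" using nz[OF \<sigma>(1)] by simp
  then show False using sep[OF mem[OF \<sigma>(1)] \<sigma>(2)] by simp
qed

lemma hfold_sumset_image:
  "hfold_sumset h X = (\<lambda>x. \<Sum>i<h. x i) ` ({..<h} \<rightarrow>\<^sub>E X)"
proof -
  have "\<exists>y \<in> {..<h} \<rightarrow>\<^sub>E X. (\<Sum>i<h. x i) = (\<Sum>i<h. y i)" if "\<forall>i<h. x i \<in> X" for x :: "nat \<Rightarrow> 'a"
    using that by (intro bexI[of _ "restrict x {..<h}"]) auto
  then show ?thesis unfolding hfold_sumset_eq by fastforce
qed

lemma finite_hfold_sumset: "finite X \<Longrightarrow> finite (hfold_sumset h X)"
  unfolding hfold_sumset_image by (intro finite_imageI finite_PiE) auto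

lemma hfold_sumset_mono: "X \<subseteq> Y \<Longrightarrow> hfold_sumset h X \<subseteq> hfold_sumset h Y"
  unfolding hfold_sumset_eq by blast

lemma sum_in_hfold_sumset:
  assumes "finite I" "card I = h" "\<And>i. i \<in> I \<Longrightarrow> g i \<in> X"
  shows "sum g I \<in> hfold_sumset h X"
proof -
  obtain f where f: "bij_betw f {..<h} I"
    using ex_bij_betw_nat_finite[OF assms(1)] assms(2) by (auto simp: atLeast0LessThan)
  then have "sum g I = (\<Sum>i<h. g (f i))" by (simp add: sum.reindex_bij_betw)
  moreover have "\<forall>i<h. g (f i) \<in> X" using f assms(3) by (auto simp: bij_betw_def)
  ultimately show ?thesis unfolding hfold_sumset_eq by blast
qed

lemma card_hfold_sumset_mono:
  fixes X :: "real set"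
  assumes "h \<le> h'" "finite X" "X \<noteq> {}"
  shows "card (hfold_sumset h X) \<le> card (hfold_sumset h' X)"
proof (rule lift_Suc_mono_le[OF _ assms(1)])
  fix h
  obtain x where x: "x \<in> X" using assms(3) by blast
  have "(\<lambda>y. y + x) ` hfold_sumset h X \<subseteq> hfold_sumset (Suc h) X"
    using x unfolding hfold_sumset_def by (auto simp: set_plus_def)
  then have "card ((\<lambda>y. y + x) ` hfold_sumset h X) \<le> card (hfold_sumset (Suc h) X)"
    using assms by (intro card_mono finite_hfold_sumset)
  then show "card (hfold_sumset h X) \<le> card (hfold_sumset (Suc h) X)"
    by (simp add: card_image)
qed

lemma card_hfold_sumset_scale:
  fixes X :: "real set"
  assumes "c \<noteq> 0"
  shows "card (hfold_sumset h ((\<lambda>x. c * x) ` X)) = card (hfold_sumset h X)"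
proof -
  have "hfold_sumset h ((\<lambda>x. c * x) ` X) = (\<lambda>x. c * x) ` hfold_sumset h X"
  proof (intro equalityI subsetI)
    fix s assume "s \<in> hfold_sumset h ((\<lambda>x. c * x) ` X)"
    then obtain y where y: "s = (\<Sum>i<h. y i)" "\<forall>i<h. y i \<in> (\<lambda>x. c * x) ` X"
      unfolding hfold_sumset_eq by blast
    then have "s = c * (\<Sum>i<h. y i / c)" "\<forall>i<h. y i / c \<in> X"
      using assms by (auto simp: sum_distrib_left)
    then show "s \<in> (\<lambda>x. c * x) ` hfold_sumset h X" unfolding hfold_sumset_eq by blast
  next
    fix s assume "s \<in> (\<lambda>x. c * x) ` hfold_sumset h X"
    then obtain y where y: "s = (\<Sum>i<h. c * y i)" "\<forall>i<h. y i \<in> X"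
      unfolding hfold_sumset_eq by (auto simp: sum_distrib_left)
    then show "s \<in> hfold_sumset h ((\<lambda>x. c * x) ` X)" unfolding hfold_sumset_eq by blast
  qed
  then show ?thesis using assms by (simp add: card_image inj_on_def)
qed

text \<open>Passing from the difference of two \<open>h\<close>-fold sums back to a single one costs only a square.\<close>

lemma card_power_le_hfold_sumset_square:
  fixes A X :: "real set" and e e' :: "nat \<Rightarrow> 'i \<Rightarrow> nat"
  assumes S: "finite S" and T: "finite T" and X: "finite X"
    and diam: "\<And>a b. a \<in> A \<Longrightarrow> b \<in> A \<Longrightarrow> \<bar>a - b\<bar> \<le> d"
    and sep: "\<And>a b. a \<in> A \<Longrightarrow> b \<in> A \<Longrightarrow> a \<noteq> b \<Longrightarrow> \<bar>a - b\<bar> > d * L"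
    and nz: "\<And>\<sigma>. \<sigma> \<in> S \<Longrightarrow> exp_gap T (e \<sigma>) (e' \<sigma>) u \<noteq> 0"
    and tail: "\<And>\<sigma>. \<sigma> \<in> S \<Longrightarrow>
      (\<Sum>\<tau> | \<tau> \<in> S \<and> \<sigma> < \<tau>. \<bar>exp_gap T (e \<tau>) (e' \<tau>) u\<bar>) \<le> L * \<bar>exp_gap T (e \<sigma>) (e' \<sigma>) u\<bar>"
    and mem: "\<And>a \<sigma> i. a \<in> A \<Longrightarrow> \<sigma> \<in> S \<Longrightarrow> i \<in> T \<Longrightarrow>
      a * exp (real (e \<sigma> i) * u) \<in> X \<and> a * exp (real (e' \<sigma> i) * u) \<in> X"
  shows "card A ^ card S \<le> (card (hfold_sumset (card S * card T) X))\<^sup>2"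
proof -
  let ?H = "hfold_sumset (card S * card T) X"
  define P :: "(nat \<Rightarrow> 'i \<Rightarrow> nat) \<Rightarrow> (nat \<Rightarrow> real) \<Rightarrow> real" where "P e a = (\<Sum>x\<in>S \<times> T. a (fst x) * exp (real (e (fst x) (snd x)) * u))" for e a
  have P: "P e a = (\<Sum>\<sigma>\<in>S. a \<sigma> * (\<Sum>i\<in>T. exp (real (e \<sigma> i) * u)))" for e a
    unfolding P_def by (simp add: sum.cartesian_product' sum_distrib_left)
  have "inj_on (\<lambda>a. \<Sum>\<sigma>\<in>S. a \<sigma> * exp_gap T (e \<sigma>) (e' \<sigma>) u) (S \<rightarrow>\<^sub>E A)"
    by (rule inj_on_graded_sum[OF S diam sep nz tail])
  moreover have "(\<Sum>\<sigma>\<in>S. a \<sigma> * exp_gap T (e \<sigma>) (e' \<sigma>) u) = P e a - P e' a" for a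
    unfolding P exp_gap_def by (simp add: algebra_simps sum_subtractf)
  \<comment> \<open>The difference of the two sums determines a, hence so does the pair; this pair
    is the source of the square.\<close>
  ultimately have inj: "inj_on (\<lambda>a. (P e a, P e' a)) (S \<rightarrow>\<^sub>E A)"
    by (auto simp: inj_on_def)
  have "card (S \<rightarrow>\<^sub>E A) \<le> card (?H \<times> ?H)"
  proof (rule card_inj_on_le[OF inj])
    show "(\<lambda>a. (P e a, P e' a)) ` (S \<rightarrow>\<^sub>E A) \<subseteq> ?H \<times> ?H"
    proof (rule image_subsetI)
      fix a assume "a \<in> S \<rightarrow>\<^sub>E A"
      then have "a \<sigma> \<in> A" if "\<sigma> \<in> S" for \<sigma> using that by auto
      then show "(P e a, P e' a) \<in> ?H \<times> ?H"
        unfolding P_def using S T mem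
        by (auto intro!: sum_in_hfold_sumset simp: card_cartesian_product)
    qed
  qed (use X in \<open>auto intro: finite_hfold_sumset\<close>)
  then show ?thesis using S by (simp add: card_PiE card_cartesian_product power2_eq_square)
qed

section \<open>Small doubling\<close>

text \<open>Minus between sets already denotes set difference, hence a separate name for the
  Minkowski difference.\<close>

definition diffset :: "'a::ab_group_add set \<Rightarrow> 'a set \<Rightarrow> 'a set" where
  "diffset A B = (\<lambda>(a, b). a - b) ` (A \<times> B)"

lemma diffsetI: "a \<in> A \<Longrightarrow> b \<in> B \<Longrightarrow> a - b \<in> diffset A B"
  unfolding diffset_def by auto

lemma finite_diffset: "finite A \<Longrightarrow> finite B \<Longrightarrow> finite (diffset A B)"
  unfolding diffset_def by auto

lemma diffset_mono: "A \<subseteq> A' \<Longrightarrow> B \<subseteq> B' \<Longrightarrow> diffset A B \<subseteq> diffset A' B'"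
  unfolding diffset_def by auto

lemma card_translate_le:
  fixes A :: "'a::ab_group_add set"
  assumes "finite B" "\<And>a. a \<in> A \<Longrightarrow> a + x \<in> B"
  shows "card A \<le> card B"
proof (rule card_inj_on_le[of "\<lambda>a. a + x"])
  show "inj_on (\<lambda>a. a + x) A" by (simp add: inj_on_def)
qed (use assms in auto)

section \<open>Bounds of Plunnecke-Ruzsa type\<close>

text \<open>Fix one representation u d - v d of each difference d. From the pair (u d + w, v d + w),
  subtraction recovers d, and then w is known.\<close>

lemma ruzsa_triangle:
  fixes U V W :: "'a::ab_group_add set"
  assumes fin: "finite U" "finite V" "finite W"
  shows "card (diffset U V) * card W \<le> card (U + W) * card (V + W)"
proof -
  have "\<exists>u v. u \<in> U \<and> v \<in> V \<and> d = u - v" if "d \<in> diffset U V" for d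
    using that unfolding diffset_def by auto
  then obtain u v where uv: "\<And>d. d \<in> diffset U V \<Longrightarrow> u d \<in> U \<and> v d \<in> V \<and> d = u d - v d"
    by metis
  have "card (diffset U V \<times> W) \<le> card ((U + W) \<times> (V + W))"
  proof (rule card_inj_on_le[of "\<lambda>(d, w). (u d + w, v d + w)"])
    show "inj_on (\<lambda>(d, w). (u d + w, v d + w)) (diffset U V \<times> W)"
    proof (rule inj_onI, clarify)
      fix d w d' w' assume d: "d \<in> diffset U V" "d' \<in> diffset U V"
        and eq: "u d + w = u d' + w'" "v d + w = v d' + w'"
      have "(u d + w) - (v d + w) = (u d' + w') - (v d' + w')" using eq by simp
      then have "d = d'" using uv[OF d(1)] uv[OF d(2)] by simp
      then show "d = d' \<and> w = w'" using eq by simp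
    qed
    show "(\<lambda>(d, w). (u d + w, v d + w)) ` (diffset U V \<times> W) \<subseteq> (U + W) \<times> (V + W)"
      using uv by auto
  qed (use fin in \<open>auto intro: finite_set_plus\<close>)
  then show ?thesis by (simp add: card_cartesian_product)
qed

text \<open>Petridis' induction on \<open>C\<close>, for an X minimising |Y + A| / |Y| among its own
  nonempty subsets. Adding c enlarges C + X + A by at most |X + A| - |Y + A| and C + X by at least
  |X| - |Y|, for the set Y chosen below; minimality applied to Y compares the two
  increments.\<close>

lemma petridis:
  fixes X A C :: "'a::ab_group_add set"
  assumes fin: "finite X" "finite A" and C: "finite C"
    and min: "\<And>Y. Y \<subseteq> X \<Longrightarrow> card (X + A) * card Y \<le> card (Y + A) * card X"
  shows "card (C + X + A) * card X \<le> card (X + A) * card (C + X)"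
  using C
proof (induction C rule: finite_induct)
  case empty
  have "{} + X = {}" "{} + A = {}" by (auto simp: set_plus_def)
  then show ?case by simp
next
  case (insert c C)
  \<comment> \<open>The x whose translate c + x + A brings nothing new. If c + x already lies in C +
    X, then x lies in Y, so each x outside Y yields a new element of C + X.\<close>
  define Y where "Y = {x \<in> X. \<forall>a\<in>A. c + x + a \<in> C + X + A}"
  have YX: "Y \<subseteq> X" by (auto simp: Y_def)
  let ?t = "\<lambda>x. c + x"
  have inj: "inj_on ?t Z" for Z by (simp add: inj_on_def)
  have finCX: "finite (C + X)" "finite (C + X + A)" "finite (X + A)"
    using fin insert by (auto intro!: finite_set_plus)
  have sub: "Y + A \<subseteq> X + A" using YX by (auto simp: set_plus_def)
  have "insert c C + X + A \<subseteq> (C + X + A) \<union> ?t ` (X + A - (Y + A))"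
  proof
    fix z assume "z \<in> insert c C + X + A"
    then obtain d x a where z: "z = d + x + a" "d \<in> insert c C" "x \<in> X" "a \<in> A"
      by (auto elim!: set_plus_elim)
    show "z \<in> (C + X + A) \<union> ?t ` (X + A - (Y + A))"
    proof (cases "z \<in> C + X + A")
      case False
      then have "d = c" using z by auto
      have "x + a \<notin> Y + A"
      proof
        assume "x + a \<in> Y + A"
        then obtain y b where "x + a = y + b" "y \<in> Y" "b \<in> A" by (auto elim!: set_plus_elim)
        then have "z \<in> C + X + A"
          using z(1) \<open>d = c\<close> unfolding Y_def by (metis (mono_tags, lifting) add.assoc mem_Collect_eq)
        then show False using False by simp
      qed
      then have "x + a \<in> X + A - (Y + A)" using z by auto
      moreover have "z = ?t (x + a)" using z(1) \<open>d = c\<close> by (simp add: add.assoc)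
      ultimately show ?thesis by blast
    qed simp
  qed
  then have "card (insert c C + X + A) \<le> card ((C + X + A) \<union> ?t ` (X + A - (Y + A)))"
    using finCX by (intro card_mono) auto
  also have "\<dots> \<le> card (C + X + A) + card (X + A - (Y + A))"
    using card_Un_le[of "C + X + A" "?t ` (X + A - (Y + A))"] by (simp add: card_image[OF inj])
  also have "card (X + A - (Y + A)) = card (X + A) - card (Y + A)"
    using finCX sub finite_subset by (intro card_Diff_subset) auto
  finally have up: "card (insert c C + X + A) + card (Y + A) \<le> card (C + X + A) + card (X + A)"
    using card_mono[OF finCX(3) sub] by simp
  have "(C + X) \<union> ?t ` (X - Y) \<subseteq> insert c C + X" using YX by (auto simp: set_plus_def)
  then have "card ((C + X) \<union> ?t ` (X - Y)) \<le> card (insert c C + X)"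
    using fin insert by (intro card_mono finite_set_plus) auto
  moreover have "(C + X) \<inter> ?t ` (X - Y) = {}"
    unfolding Y_def by auto
  then have "card ((C + X) \<union> ?t ` (X - Y)) = card (C + X) + card (X - Y)"
    using finCX fin by (subst card_Un_disjoint) (auto simp: card_image[OF inj])
  ultimately have low: "card (C + X) + card X \<le> card (insert c C + X) + card Y"
    using card_Diff_subset[of Y X] YX fin finite_subset[OF YX] card_mono[OF fin(1) YX] by simp
  have "card (insert c C + X + A) * card X + card (X + A) * card Y
      \<le> card (insert c C + X + A) * card X + card (Y + A) * card X"
    using min[OF YX] by simp
  also have "\<dots> \<le> (card (C + X + A) + card (X + A)) * card X"
    using mult_le_mono1[OF up, of "card X"] by (simp add: algebra_simps)
  also have "\<dots> \<le> card (X + A) * card (C + X) + card (X + A) * card X"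
    using insert.IH by (simp add: algebra_simps)
  also have "\<dots> \<le> card (X + A) * (card (insert c C + X) + card Y)"
    using mult_le_mono2[OF low, of "card (X + A)"] by (simp add: algebra_simps)
  finally show ?case by (simp add: algebra_simps)
qed

text \<open>Division-free form of |2A - 2A| <= K^4 |A| for K = |A + A| / |A|. For X minimising |Y +
  A| / |Y| over nonempty subsets of A, Petridis with C = A bounds |A + A + X| by |X + A|^2 / |X|;
  the Ruzsa triangle through X then bounds |2A - 2A| by |A + A + X|^2 / |X|, and the ratio at X is
  at most the ratio at A.\<close>

lemma card_double_diffset_le:
  fixes A :: "'a::ab_group_add set"
  assumes A: "finite A" "A \<noteq> {}"
  shows "card (diffset (A + A) (A + A)) * card A ^ 3 \<le> card (A + A) ^ 4"
proof -
  define ratio where "ratio Y = real (card (Y + A)) / real (card Y)" for Y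
  have finP: "finite (Pow A - {{}})" and neP: "Pow A - {{}} \<noteq> {}" using A by auto
  obtain X where X: "X \<in> Pow A - {{}}" "\<And>Y. Y \<in> Pow A - {{}} \<Longrightarrow> ratio X \<le> ratio Y"
    using ex_is_arg_min_if_finite[OF finP neP, of ratio] by (auto simp: is_arg_min_linorder)
  have XA: "X \<subseteq> A" "X \<noteq> {}" using X by auto
  have finX: "finite X" using A XA finite_subset by blast
  have cX: "card X > 0" and cA: "card A > 0" using XA finX A by (auto simp: card_gt_0_iff)
  have min: "card (X + A) * card Y \<le> card (Y + A) * card X" if "Y \<subseteq> A" for Y
  proof (cases "Y = {}")
    case False
    then have "ratio X \<le> ratio Y" using that by (intro X) auto
    moreover have "card Y > 0" using False that A finite_subset by (auto simp: card_gt_0_iff)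
    ultimately have "real (card (X + A)) * real (card Y) \<le> real (card (Y + A)) * real (card X)"
      using cX by (simp add: ratio_def field_simps)
    then show ?thesis by (metis of_nat_le_iff of_nat_mult)
  qed simp
  have AXA: "card (A + X + A) * card X \<le> card (X + A) * card (A + X)"
    using XA min by (intro petridis finX A) auto
  define a x p t where "a = real (card A)" and "x = real (card X)" and "p = real (card (A + A))"
    and "t = real (card (X + A))"
  have pos: "a > 0" "x > 0" using cX cA by (auto simp: a_def x_def)
  have 1: "t * a \<le> p * x" using min[of A] unfolding a_def x_def p_def t_def by (metis order_refl of_nat_le_iff of_nat_mult)
  define w where "w = real (card (A + A + X))"
  have "A + X + A = A + A + X" by (simp add: add_ac)
  then have 2: "w * x \<le> t * t"
    using AXA unfolding w_def x_def t_def by (metis add.commute of_nat_le_iff of_nat_mult)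
  have "card (diffset (A + A) (A + A)) * card X \<le> card (A + A + X) * card (A + A + X)"
    using A finX by (intro ruzsa_triangle finite_set_plus)
  then have 3: "real (card (diffset (A + A) (A + A))) * x \<le> w * w"
    unfolding w_def x_def by (metis of_nat_le_iff of_nat_mult)
  define d where "d = real (card (diffset (A + A) (A + A)))"
  have nn: "w \<ge> 0" "t \<ge> 0" "d \<ge> 0" "p \<ge> 0" by (auto simp: w_def t_def d_def p_def)
  have "d * x ^ 3 = (d * x) * x\<^sup>2" by (simp add: power2_eq_square power3_eq_cube)
  also have "\<dots> \<le> (w * w) * x\<^sup>2" using 3 unfolding d_def by (intro mult_right_mono) auto
  also have "\<dots> = (w * x)\<^sup>2" by (simp add: power2_eq_square)
  also have "\<dots> \<le> (t * t)\<^sup>2" using 2 nn pos by (intro power_mono) auto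
  finally have 4: "d * x ^ 3 \<le> t ^ 4" by (simp add: power2_eq_square power4_eq_xxxx mult_ac)
  have "d * x ^ 3 * a ^ 4 \<le> t ^ 4 * a ^ 4" using 4 pos by (intro mult_right_mono) auto
  also have "\<dots> = (t * a) ^ 4" by (simp add: power_mult_distrib)
  also have "\<dots> \<le> (p * x) ^ 4" using 1 nn pos by (intro power_mono) auto
  finally have "d * a ^ 4 * x ^ 3 \<le> p ^ 4 * x * x ^ 3"
    by (simp add: power_mult_distrib power4_eq_xxxx power3_eq_cube mult_ac)
  then have "d * a ^ 4 \<le> p ^ 4 * x" using pos by simp
  also have "\<dots> \<le> p ^ 4 * a" using XA A card_mono by (intro mult_left_mono) (auto simp: x_def a_def)
  finally have "(d * a ^ 3) * a \<le> p ^ 4 * a" by (simp add: power4_eq_xxxx power3_eq_cube mult_ac)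
  then have "d * a ^ 3 \<le> p ^ 4" using pos by simp
  then have "real (card (diffset (A + A) (A + A)) * card A ^ 3) \<le> real (card (A + A) ^ 4)"
    by (simp add: d_def a_def p_def)
  then show ?thesis by (simp only: of_nat_le_iff)
qed

section \<open>Pigeonhole on second differences\<close>

lemma pigeonhole_fiber:
  assumes "finite T" "finite R" "R \<noteq> {}" "f ` T \<subseteq> R"
  obtains y where "y \<in> R" "card T \<le> card {x \<in> T. f x = y} * card R"
proof -
  have "\<exists>y\<in>R. card T \<le> card {x \<in> T. f x = y} * card R"
  proof (rule ccontr)
    assume "\<not> ?thesis"
    then have "(\<Sum>y\<in>R. card {x \<in> T. f x = y} * card R) < (\<Sum>y\<in>R. card T)"
      using assms by (intro sum_strict_mono) (auto simp: not_le)
    moreover have "(\<Sum>y\<in>R. card {x \<in> T. f x = y}) = card T"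
      using sum.group[OF assms(1,2,4), of "\<lambda>_. 1::nat"] by simp
    ultimately show False by (simp add: sum_distrib_right [symmetric])
  qed
  then show thesis using that by blast
qed

text \<open>The tuples in one fibre of the map taking second differences differ from one another by
  arithmetic progressions; a tuple is recorded by its initial term and its initial step.\<close>

lemma many_progressions_in_diffset:
  fixes C :: "real set" and D :: nat
  assumes C: "finite C" "C \<noteq> {}"
  obtains P where "P \<subseteq> C \<times> diffset C C"
    "card C ^ (D + 2) \<le> card P * card (diffset (C + C) (C + C)) ^ D"
    "\<And>a x. (a, x) \<in> P \<Longrightarrow> a + x \<in> C"
    "\<And>a x b y e. (a, x) \<in> P \<Longrightarrow> (b, y) \<in> P \<Longrightarrow> e \<le> D + 1 \<Longrightarrow>
       (a - b) + real e * (x - y) \<in> diffset C C"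
proof -
  let ?T = "{..<D + 2} \<rightarrow>\<^sub>E C" and ?R = "{..<D} \<rightarrow>\<^sub>E diffset (C + C) (C + C)"
  \<comment> \<open>D second differences in 2C - 2C stand against D + 2 free entries: if 2C - 2C has
    K |C| elements, an average fibre contains at least |C|^2 / K^D tuples.\<close>
  define f where "f c = restrict (\<lambda>i. (c i + c (Suc (Suc i))) - (c (Suc i) + c (Suc i))) {..<D}"
    for c :: "nat \<Rightarrow> real"
  have img: "f ` ?T \<subseteq> ?R"
  proof (rule image_subsetI)
    fix c assume "c \<in> ?T"
    then have "c i \<in> C" if "i < D + 2" for i using that by (auto simp: PiE_iff)
    then show "f c \<in> ?R"
      unfolding f_def by (intro restrict_PiE_iff[THEN iffD2] ballI diffsetI set_plus_intro) auto
  qed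
  have fin: "finite ?T" "finite ?R"
    using C by (intro finite_PiE finite_diffset finite_set_plus finite_lessThan; simp)+
  have "diffset (C + C) (C + C) \<noteq> {}"
    using C(2) by (auto simp: diffset_def set_plus_def)
  then have "?R \<noteq> {}" by (simp add: PiE_eq_empty_iff)
  then obtain y where y: "card ?T \<le> card {c \<in> ?T. f c = y} * card ?R"
    by (rule pigeonhole_fiber[OF fin _ img])
  define \<Phi> where "\<Phi> = {c \<in> ?T. f c = y}"
  define g where "g c = (c 0, c 1 - c 0)" for c :: "nat \<Rightarrow> real"
  have mem: "c i \<in> C" if "c \<in> \<Phi>" "i \<le> D + 1" for c i
    using that by (auto simp: \<Phi>_def PiE_iff)
  have prog: "c i - c' i = (c 0 - c' 0) + real i * ((c 1 - c 0) - (c' 1 - c' 0))"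
    if "c \<in> \<Phi>" "c' \<in> \<Phi>" "i \<le> D + 1" for c c' i
    using that(3)
  proof (induction i rule: less_induct)
    case (less i)
    consider "i = 0" | "i = 1" | j where "i = Suc (Suc j)" by (cases i; cases "i - 1") auto
    then show ?case
    proof cases
      case 3
      then have j: "j < D" using less.prems by simp
      have "f c j = f c' j" using that(1,2) by (auto simp: \<Phi>_def)
      then have "c i - c' i = 2 * (c (Suc j) - c' (Suc j)) - (c j - c' j)"
        using j 3 by (simp add: f_def)
      then show ?thesis
        using less.IH[of j] less.IH[of "Suc j"] less.prems 3 by (simp add: algebra_simps)
    qed auto
  qed
  have "inj_on g \<Phi>"
  proof (rule inj_onI)
    fix c c' assume c: "c \<in> \<Phi>" "c' \<in> \<Phi>" and "g c = g c'"
    then have "c 0 = c' 0" "c 1 = c' 1" by (auto simp: g_def)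
    then have "c i = c' i" if "i < D + 2" for i
      using prog[OF c, of i] that by simp
    then show "c = c'" using c unfolding \<Phi>_def by (intro PiE_ext[of c "{..<D + 2}" _ c']) auto
  qed
  then have "card (g ` \<Phi>) = card \<Phi>" by (rule card_image)
  show thesis
  proof (rule that[of "g ` \<Phi>"])
    show "g ` \<Phi> \<subseteq> C \<times> diffset C C" using mem by (auto simp: g_def intro!: diffsetI)
    show "card C ^ (D + 2) \<le> card (g ` \<Phi>) * card (diffset (C + C) (C + C)) ^ D"
      using y \<open>card (g ` \<Phi>) = card \<Phi>\<close> by (simp add: card_PiE \<Phi>_def)
    show "a + x \<in> C" if "(a, x) \<in> g ` \<Phi>" for a x
      using that mem by (auto simp: g_def)
    show "(a - b) + real e * (x - y) \<in> diffset C C"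
      if "(a, x) \<in> g ` \<Phi>" "(b, y) \<in> g ` \<Phi>" "e \<le> D + 1" for a x b y e
    proof -
      obtain c c' where c: "c \<in> \<Phi>" "c' \<in> \<Phi>" "(a, x) = g c" "(b, y) = g c'"
        using \<open>(a, x) \<in> g ` \<Phi>\<close> \<open>(b, y) \<in> g ` \<Phi>\<close> by blast
      then have "(a - b) + real e * (x - y) = c e - c' e"
        using prog[OF c(1,2) \<open>e \<le> D + 1\<close>] by (simp add: g_def)
      then show ?thesis using mem c \<open>e \<le> D + 1\<close> by (auto intro!: diffsetI)
    qed
  qed
qed

section \<open>Cells on the real line\<close>

text \<open>Index of the dyadic interval of length 2^(-i) containing c. Dyadic scales nest, so a
  coarser index is an integer quotient of a finer one and refinement by one level at most doubles
  the number of occupied cells.\<close>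

definition cell :: "nat \<Rightarrow> real \<Rightarrow> int" where
  "cell i c = \<lfloor>2 ^ i * c\<rfloor>"

lemma cell_div: "cell (i + j) c div 2 ^ j = cell i c"
proof -
  have "cell i c = \<lfloor>(2 ^ (i + j) * c) / real_of_int (2 ^ j)\<rfloor>"
    by (simp add: cell_def power_add)
  then show ?thesis by (simp only: floor_divide_real_eq_div cell_def zero_le_power zero_le_numeral)
qed

lemma cell_eq_dist: "cell i a = cell i b \<Longrightarrow> 2 ^ i * \<bar>a - b\<bar> < 1"
proof -
  assume "cell i a = cell i b"
  then have "\<bar>2 ^ i * a - 2 ^ i * b\<bar> < 1" unfolding cell_def by linarith
  then show ?thesis by (simp add: abs_mult flip: right_diff_distrib)
qed

lemma cell_far_dist:
  assumes "\<bar>cell i a - cell i b\<bar> \<ge> int L"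
  shows "2 ^ i * \<bar>a - b\<bar> > real L - 1"
proof -
  have "\<bar>2 ^ i * a - 2 ^ i * b\<bar> > real L - 1" using assms unfolding cell_def by linarith
  then show ?thesis by (simp add: abs_mult flip: right_diff_distrib)
qed

lemma card_cells_le:
  assumes "finite C"
  shows "card (cell (i + j) ` C) \<le> 2 ^ j * card (cell i ` C)"
proof -
  have "card (cell (i + j) ` C) \<le> card ((cell i ` C) \<times> {0..<(2::int) ^ j})"
  proof (rule card_inj_on_le[of "\<lambda>v. (v div 2 ^ j, v mod 2 ^ j)"])
    show "inj_on (\<lambda>v. (v div 2 ^ j, v mod 2 ^ j)) (cell (i + j) ` C)"
      by (rule inj_onI) (metis div_mult_mod_eq prod.inject)
    show "(\<lambda>v. (v div 2 ^ j, v mod 2 ^ j)) ` cell (i + j) ` C \<subseteq> cell i ` C \<times> {0..<2 ^ j}"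
      by (auto simp: cell_div)
  qed (use assms in auto)
  then show ?thesis by (simp add: card_cartesian_product nat_power_eq mult.commute)
qed

lemma ex_inj_on_cell:
  assumes "finite C"
  shows "\<exists>i. inj_on (cell i) C"
proof -
  define \<delta> where "\<delta> = Min (insert 1 ((\<lambda>(a, b). \<bar>a - b\<bar>) ` ((C \<times> C) - Id)))"
  have fin: "finite ((\<lambda>(a, b). \<bar>a - b\<bar>) ` ((C \<times> C) - Id))" using assms by auto
  then have \<delta>: "\<delta> > 0" unfolding \<delta>_def by (subst Min_gr_iff) auto
  have gap: "\<delta> \<le> \<bar>a - b\<bar>" if "a \<in> C" "b \<in> C" "a \<noteq> b" for a b
    unfolding \<delta>_def using that fin by (intro Min_le) (auto intro!: image_eqI[of _ _ "(a, b)"])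
  obtain i where i: "1 / \<delta> < 2 ^ i" using real_arch_pow[of 2 "1 / \<delta>"] by auto
  have "inj_on (cell i) C"
  proof (rule inj_onI, rule ccontr)
    fix a b assume ab: "a \<in> C" "b \<in> C" "cell i a = cell i b" "a \<noteq> b"
    have "1 < 2 ^ i * \<delta>" using i \<delta> by (simp add: field_simps)
    also have "\<dots> \<le> 2 ^ i * \<bar>a - b\<bar>" using gap ab by (intro mult_left_mono) auto
    finally show False using cell_eq_dist[OF ab(3)] by simp
  qed
  then show ?thesis by blast
qed

text \<open>Translating one cell by a representative of each of the others gives nearly disjoint sets.
  Hence small doubling forces every cell to carry at most its fair share of \<open>C\<close>.\<close>

lemma cell_mass_le:
  assumes C: "finite C"
  shows "card {c \<in> C. cell i c = v} * card (cell i ` C) \<le> 2 * card (C + C)"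
proof -
  have "\<exists>c\<in>C. cell i c = w" if "w \<in> cell i ` C" for w using that by auto
  then obtain r where r: "\<And>w. w \<in> cell i ` C \<Longrightarrow> r w \<in> C \<and> cell i (r w) = w" by metis
  \<comment> \<open>Rounding is additive up to a carry in {0, 1}. For c in cell v, the sum c + r w
    and its carry reveal w, hence c; the carry accounts for the factor 2.\<close>
  have add: "cell i (a + b) - cell i a - cell i b \<in> {0, 1}" for a b
    by (simp add: cell_def distrib_left floor_add)
  have "card ({c \<in> C. cell i c = v} \<times> cell i ` C) \<le> card ((C + C) \<times> {0, 1::int})"
  proof (rule card_inj_on_le[of "\<lambda>(c, w). (c + r w, cell i (c + r w) - v - w)"])
    show "inj_on (\<lambda>(c, w). (c + r w, cell i (c + r w) - v - w)) ({c \<in> C. cell i c = v} \<times> cell i ` C)"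
    proof (rule inj_onI)
      fix x y :: "real \<times> int"
      assume eq: "(\<lambda>(c, w). (c + r w, cell i (c + r w) - v - w)) x
        = (\<lambda>(c, w). (c + r w, cell i (c + r w) - v - w)) y"
      obtain c w c' w' where xy: "x = (c, w)" "y = (c', w')" by (cases x, cases y) auto
      have 1: "c + r w = c' + r w'" and 2: "cell i (c + r w) - v - w = cell i (c' + r w') - v - w'"
        using eq unfolding xy prod.case prod.inject by blast+
      have "w = w'" using 2 unfolding 1 by simp
      then show "x = y" using 1 by (simp add: xy)
    qed
    show "(\<lambda>(c, w). (c + r w, cell i (c + r w) - v - w)) ` ({c \<in> C. cell i c = v} \<times> cell i ` C)
        \<subseteq> (C + C) \<times> {0, 1}"
    proof (rule image_subsetI, clarify)
      fix c c' assume c: "c \<in> C" "v = cell i c" "c' \<in> C"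
      note rc = r[OF imageI[OF c(3), of "cell i"]]
      have "cell i (c + r (cell i c')) - cell i c - cell i c' \<in> {0, 1}"
        using add[of c "r (cell i c')"] rc by simp
      then show "c + r (cell i c') \<in> C + C \<and> cell i (c + r (cell i c')) - cell i c - cell i c' \<in> {0, 1}"
        using c rc by auto
    qed
  qed (use C in \<open>auto intro: finite_set_plus\<close>)
  then show ?thesis by (simp add: card_cartesian_product mult.commute)
qed

text \<open>One point is taken from each cell in a popular class, a class being given by the index
  modulo L and the value of \<open>g\<close>. Distinct congruent indices differ by at least L, and
  rounding loses less than one cell. The parameter g serves to confine the points to one unit
  interval; a constant g leaves only the congruence.\<close>

lemma select_separated:
  fixes L :: nat and g :: "int \<Rightarrow> int"
  assumes A: "finite A" "A \<noteq> {}" and L: "L \<ge> 1"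
  obtains B where "B \<subseteq> A" "card (cell i ` A) \<le> card B * (card (g ` cell i ` A) * L)"
    "\<And>a b. a \<in> B \<Longrightarrow> b \<in> B \<Longrightarrow> g (cell i a) = g (cell i b)"
    "\<And>a b. a \<in> B \<Longrightarrow> b \<in> B \<Longrightarrow> a \<noteq> b \<Longrightarrow> 2 ^ i * \<bar>a - b\<bar> > real L - 1"
proof -
  let ?W = "cell i ` A" and ?R = "(g ` cell i ` A) \<times> {0..<int L}"
  define f where "f v = (g v, v mod int L)" for v
  have fin: "finite ?W" "finite ?R" using A by auto
  have ne: "?R \<noteq> {}" and im: "f ` ?W \<subseteq> ?R" using A L by (auto simp: f_def)
  obtain y where y: "card ?W \<le> card {v \<in> ?W. f v = y} * card ?R"
    by (rule pigeonhole_fiber[OF fin ne im])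
  define V where "V = {v \<in> ?W. f v = y}"
  have "\<exists>c\<in>A. cell i c = w" if "w \<in> V" for w using that by (auto simp: V_def)
  then obtain r where r: "\<And>w. w \<in> V \<Longrightarrow> r w \<in> A \<and> cell i (r w) = w" by metis
  have inj: "inj_on r V" by (rule inj_onI) (metis r)
  show thesis
  proof (rule that[of "r ` V"])
    show "r ` V \<subseteq> A" using r by auto
    show "card ?W \<le> card (r ` V) * (card (g ` cell i ` A) * L)"
      using y card_image[OF inj] by (simp add: V_def card_cartesian_product)
    show "g (cell i a) = g (cell i b)" if "a \<in> r ` V" "b \<in> r ` V" for a b
      using that r by (auto simp: V_def f_def)
    show "2 ^ i * \<bar>a - b\<bar> > real L - 1" if "a \<in> r ` V" "b \<in> r ` V" "a \<noteq> b" for a b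
    proof (rule cell_far_dist)
      obtain v w where vw: "v \<in> V" "w \<in> V" "a = r v" "b = r w" using \<open>a \<in> r ` V\<close> \<open>b \<in> r ` V\<close> by auto
      then have "v \<noteq> w" using \<open>a \<noteq> b\<close> by auto
      have "v mod int L = w mod int L" using vw by (auto simp: V_def f_def)
      then have "int L dvd v - w" by (simp add: mod_eq_dvd_iff)
      then have "int L \<le> \<bar>v - w\<bar>" using \<open>v \<noteq> w\<close> dvd_imp_le_int[of "v - w" "int L"] by simp
      then show "int L \<le> \<bar>cell i a - cell i b\<bar>" using r vw by simp
    qed
  qed
qed

section \<open>Lacunary sets and their subset sums\<close>

lemma lacunary_sum_less:
  fixes L :: "real set"
  assumes pos: "\<And>a. a \<in> L \<Longrightarrow> a > 0" and lac: "\<And>a b. a \<in> L \<Longrightarrow> b \<in> L \<Longrightarrow> a < b \<Longrightarrow> 2 * a \<le> b"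
  shows "finite Y \<Longrightarrow> Y \<subseteq> L \<Longrightarrow> m \<in> L \<Longrightarrow> (\<And>y. y \<in> Y \<Longrightarrow> y < m) \<Longrightarrow> \<Sum>Y < m"
proof (induction Y arbitrary: m rule: finite_linorder_max_induct)
  case (insert b Y)
  have "\<Sum>Y < b" using insert by auto
  moreover have "b \<notin> Y" using insert.hyps by auto
  ultimately have "\<Sum>(insert b Y) < 2 * b" using insert.hyps by simp
  also have "\<dots> \<le> m" using insert lac by auto
  finally show ?case .
qed (use pos in auto)

text \<open>The largest element of the symmetric difference decides which sum is larger: elements
  above it are common, and it exceeds the sum of the smaller elements of the other set.\<close>

lemma lacunary_sums_distinct:
  fixes L :: "real set"
  assumes L: "finite L" and pos: "\<And>a. a \<in> L \<Longrightarrow> a > 0"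
    and lac: "\<And>a b. a \<in> L \<Longrightarrow> b \<in> L \<Longrightarrow> a < b \<Longrightarrow> 2 * a \<le> b"
  shows "inj_on Sum (Pow L)"
proof (rule inj_onI, rule ccontr)
  fix Y Z assume YZ: "Y \<in> Pow L" "Z \<in> Pow L" "\<Sum>Y = \<Sum>Z" "Y \<noteq> Z"
  have less: "\<Sum>Z < \<Sum>Y"
    if sub: "Y \<subseteq> L" "Z \<subseteq> L" and M: "M \<in> Y" "M \<notin> Z" and above: "\<And>x. x > M \<Longrightarrow> x \<in> Y \<longleftrightarrow> x \<in> Z"
    for Y Z M
  proof -
    have fin: "finite Y" "finite Z" using sub L finite_subset by auto
    have "\<Sum>{z \<in> Z. z < M} < M"
      by (rule lacunary_sum_less[where L = L, OF pos lac]) (use sub M fin in auto)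
    moreover have same: "{z \<in> Z. M < z} = {y \<in> Y. M < y}" using above by auto
    have "\<Sum>Z = \<Sum>{z \<in> Z. z < M} + \<Sum>{y \<in> Y. M < y}"
    proof -
      have Z: "{z \<in> Z. z < M} \<union> {z \<in> Z. M < z} = Z"
        using M by (auto, metis linorder_neqE)
      have "\<Sum>({z \<in> Z. z < M} \<union> {z \<in> Z. M < z}) = \<Sum>{z \<in> Z. z < M} + \<Sum>{z \<in> Z. M < z}"
        by (rule sum.union_disjoint) (use fin in auto)
      then show ?thesis unfolding Z unfolding same .
    qed
    moreover have "M + \<Sum>{y \<in> Y. M < y} = \<Sum>(insert M {y \<in> Y. M < y})" using fin by simp
    moreover have "\<Sum>(insert M {y \<in> Y. M < y}) \<le> \<Sum>Y"
      using fin M sub pos by (intro sum_mono2) (auto intro: less_imp_le)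
    ultimately show ?thesis by linarith
  qed
  define E where "E = (Y - Z) \<union> (Z - Y)"
  have "E \<noteq> {}" using YZ by (auto simp: E_def)
  moreover have "E \<subseteq> L" using YZ by (auto simp: E_def)
  then have "finite E" using L by (rule finite_subset)
  ultimately have M: "Max E \<in> E" "\<And>x. x \<in> E \<Longrightarrow> x \<le> Max E" by auto
  have above: "x \<in> Y \<longleftrightarrow> x \<in> Z" if "x > Max E" for x
    using M(2)[of x] that by (auto simp: E_def)
  show False
    using M(1) less[of Y Z "Max E"] less[of Z Y "Max E"] above YZ by (auto simp: E_def)
qed

text \<open>At least half of the occupied unit cells have indices of one parity; points from them
  are at distance at least 1, so their exponentials have ratio at least 2. Subtracting a fixed point
  of C moves them into C - C. The h-element subsets have distinct sums, and a binomial coefficient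
  (N over h) is at least (N/h)^h.\<close>

lemma many_cells_imp_large_sumset:
  fixes C :: "real set"
  assumes C: "finite C" and h: "h \<ge> 1" and N: "2 * h \<le> card (cell 0 ` C)"
  shows "(real (card (cell 0 ` C)) / (2 * real h)) ^ h \<le> card (hfold_sumset h (exp ` diffset C C))"
proof -
  have "C \<noteq> {}" using h N by auto
  then obtain c0 where c0: "c0 \<in> C" by blast
  obtain B where B: "B \<subseteq> C" "card (cell 0 ` C) \<le> card B * (card ((\<lambda>_. 0::int) ` cell 0 ` C) * 2)"
    "\<And>a b. a \<in> B \<Longrightarrow> b \<in> B \<Longrightarrow> a \<noteq> b \<Longrightarrow> 2 ^ 0 * \<bar>a - b\<bar> > real 2 - 1"
    by (rule select_separated[OF C \<open>C \<noteq> {}\<close>, of 2 0 "\<lambda>_. 0"]) auto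
  have cB: "card (cell 0 ` C) \<le> card B * 2" using B(2) \<open>C \<noteq> {}\<close> by (simp add: image_constant_conv)
  define L where "L = (\<lambda>b. exp (b - c0)) ` B"
  have finB: "finite B" using B C finite_subset by blast
  have cL: "card L = card B" unfolding L_def by (intro card_image) (auto simp: inj_on_def)
  have lac: "2 * a \<le> b" if ab: "a \<in> L" "b \<in> L" "a < b" for a b
  proof -
    obtain x y where xy: "x \<in> B" "y \<in> B" "a = exp (x - c0)" "b = exp (y - c0)"
      using ab by (auto simp: L_def)
    then have "x < y" using ab by simp
    then have "y - x \<ge> 1" using B(3)[of x y] xy by simp
    then have "2 \<le> exp (y - x)" using exp_ge_add_one_self[of "y - x"] by linarith
    then have "a * 2 \<le> a * exp (y - x)" using xy by (intro mult_left_mono) auto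
    also have "\<dots> = b" using xy by (simp add: exp_add [symmetric])
    finally show ?thesis by simp
  qed
  have "inj_on Sum (Pow L)"
    by (rule lacunary_sums_distinct) (use finB lac in \<open>auto simp: L_def\<close>)
  then have inj: "inj_on Sum {Y. Y \<subseteq> L \<and> card Y = h}" by (rule inj_on_subset) auto
  have "h \<le> card L" using cB N cL by simp
  have "(real (card (cell 0 ` C)) / (2 * real h)) ^ h \<le> (real (card L) / real h) ^ h"
    using cB h cL by (intro power_mono) (auto simp: field_simps)
  also have "\<dots> \<le> real (card L choose h)"
    using binomial_ge_n_over_k_pow_k[OF \<open>h \<le> card L\<close>, where 'a = real] by simp
  also have "card L choose h = card {Y. Y \<subseteq> L \<and> card Y = h}"
    using finB by (subst n_subsets) (auto simp: L_def)
  also have "\<dots> \<le> card (hfold_sumset h (exp ` diffset C C))"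
  proof (rule card_inj_on_le[OF inj])
    show "Sum ` {Y. Y \<subseteq> L \<and> card Y = h} \<subseteq> hfold_sumset h (exp ` diffset C C)"
    proof (rule image_subsetI, clarify)
      fix Y assume Y: "Y \<subseteq> L" "h = card Y"
      have "Y \<subseteq> exp ` diffset C C" using Y B(1) c0 by (auto simp: L_def intro!: imageI diffsetI)
      then show "\<Sum>Y \<in> hfold_sumset (card Y) (exp ` diffset C C)"
        using Y h by (intro sum_in_hfold_sumset) (auto intro: card_ge_0_finite)
    qed
  qed (use C in \<open>auto intro!: finite_hfold_sumset finite_diffset\<close>)
  finally show ?thesis by simp
qed

text \<open>Fibres of \<open>snd\<close> below half the average size hold at most half of P in
  total. Working in P' guarantees that a step found there occurs with many first terms.\<close>

lemma card_rich_lines: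
  assumes P: "finite P"
  defines "P' \<equiv> {p \<in> P. card P \<le> 2 * card (snd ` P) * card {q \<in> P. snd q = snd p}}"
  shows "card P \<le> 2 * card P'"
proof -
  have fin: "finite (P - P')" "finite (snd ` P)" using P by auto
  have *: "2 * card (snd ` P) * card {p \<in> P - P'. snd p = x} \<le> card P" for x
  proof (cases "\<exists>p\<in>P - P'. snd p = x")
    case True
    then obtain p where p: "p \<in> P" "p \<notin> P'" "snd p = x" by auto
    have "card {p \<in> P - P'. snd p = x} \<le> card {q \<in> P. snd q = snd p}"
      using P p by (intro card_mono) auto
    then have "2 * card (snd ` P) * card {p \<in> P - P'. snd p = x}
        \<le> 2 * card (snd ` P) * card {q \<in> P. snd q = snd p}" by (rule mult_le_mono2)
    also have "\<dots> \<le> card P" using p by (auto simp: P'_def)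
    finally show ?thesis .
  next
    case False
    then have "{p \<in> P - P'. snd p = x} = {}" by blast
    then show ?thesis by (simp only: card.empty mult_0_right le0)
  qed
  have "(\<Sum>x\<in>snd ` P. card {p \<in> P - P'. snd p = x}) = card (P - P')"
    using sum.group[OF fin, of snd "\<lambda>_. 1::nat"] by auto
  then have "2 * card (snd ` P) * card (P - P')
      = (\<Sum>x\<in>snd ` P. 2 * card (snd ` P) * card {p \<in> P - P'. snd p = x})"
    by (simp only: sum_distrib_left [symmetric])
  also have "\<dots> \<le> (\<Sum>x\<in>snd ` P. card P)" by (intro sum_mono *)
  finally have "card (snd ` P) * (2 * card (P - P')) \<le> card (snd ` P) * card P" by simp
  then have "2 * card (P - P') \<le> card P" using fin P by (cases "P = {}") auto
  moreover have "card (P - P') = card P - card P'"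
    using P by (intro card_Diff_subset) (auto simp: P'_def)
  ultimately show ?thesis by linarith
qed

section \<open>Spaced families of progressions\<close>

text \<open>\<open>L\<close> prescribes the ratio of spacing to step. Two pairs (a, x) and (b, y)
  whose first terms share a cell, and whose second terms share a cell, give u = x - y. The weights
  are the differences a' - b with b fixed and a' running through first terms that share the step x;
  each of them can be moved along u inside C - C.\<close>

lemma spaced_progressions:
  fixes C :: "real set" and s K :: real and D L :: nat
  assumes C: "finite C" and s: "s > 0" "real (card C) = s ^ 4" and K: "K \<ge> 1"
    and E: "real (card (diffset (C + C) (C + C))) \<le> K * s ^ 4"
    and few: "real (card (cell 0 ` C)) < s" and big: "s\<^sup>2 > 4 * K ^ D"
  obtains B u where "u \<noteq> 0" "\<bar>u\<bar> < 2 / s" "finite B" "s \<le> real (card B) * (4 * K ^ (D + 2) * (2 * L + 1))"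
    "\<And>b e. b \<in> B \<Longrightarrow> e \<le> D + 1 \<Longrightarrow> b + real e * u \<in> diffset C C"
    "\<And>b b'. b \<in> B \<Longrightarrow> b' \<in> B \<Longrightarrow> \<bar>b - b'\<bar> < 1"
    "\<And>b b'. b \<in> B \<Longrightarrow> b' \<in> B \<Longrightarrow> b \<noteq> b' \<Longrightarrow> \<bar>b - b'\<bar> > real L * \<bar>u\<bar>"
proof -
  define N where "N i = real (card (cell i ` C))" for i
  define M where "M = real (card (diffset (C + C) (C + C)))"
  have KD: "K ^ j \<ge> 1" for j using K by simp
  have "s\<^sup>2 > 1" using big KD[of D] by linarith
  then have s1: "s > 1" using s power_le_one[of s 2] by force
  have pw: "s\<^sup>2 * s\<^sup>2 = s ^ 4" "s ^ 4 * s\<^sup>2 = s ^ 6" "s ^ 6 * s\<^sup>2 = s ^ 8" "s ^ 4 * s ^ 4 = s ^ 8"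
    by (simp_all flip: power_add)
  have Cne: "C \<noteq> {}" using s by auto
  then obtain c0 where c0: "c0 \<in> C" by blast
  have finE: "finite (diffset (C + C) (C + C))" using C by (intro finite_diffset finite_set_plus)

  have "\<exists>i. s\<^sup>2 \<le> N i"
  proof -
    obtain i where "inj_on (cell i) C" using ex_inj_on_cell[OF C] by blast
    then have "N i = s ^ 4" using s by (simp add: N_def card_image)
    moreover have "s\<^sup>2 \<le> s ^ 4" using s1 by (intro power_increasing) auto
    ultimately have "s\<^sup>2 \<le> N i" by simp
    then show ?thesis by blast
  qed
  \<comment> \<open>The first scale with s^2 cells still has fewer than 2 s^2, since refinement at
    most doubles the count. Fewer than s unit cells are occupied, so 2^i > s, which is the source of
    |u| < 2 / s.\<close>
  define i where "i = (LEAST i. s\<^sup>2 \<le> N i)"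
  have Ni: "s\<^sup>2 \<le> N i" unfolding i_def using \<open>\<exists>i. s\<^sup>2 \<le> N i\<close> by (rule LeastI_ex)
  have "s \<le> s\<^sup>2" using s1 by (simp add: power2_eq_square)
  then have "i \<noteq> 0" using Ni few unfolding N_def by (intro notI) simp
  then obtain i' where i': "i = Suc i'" by (cases i) auto
  have "N i' < s\<^sup>2" using not_less_Least[of i' "\<lambda>i. s\<^sup>2 \<le> N i"] i' unfolding i_def by auto
  moreover have "N i \<le> 2 * N i'"
    using card_cells_le[OF C, of i' 1] unfolding i' N_def by simp
  ultimately have Ni2: "N i < 2 * s\<^sup>2" by simp
  have "real (card (cell (0 + i) ` C)) \<le> real (2 ^ i * card (cell 0 ` C))"
    using card_cells_le[OF C] of_nat_le_iff by blast
  then have "N i \<le> 2 ^ i * N 0" by (simp add: N_def)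
  also have "\<dots> < 2 ^ i * s" using few by (simp add: N_def)
  finally have "s * s < 2 ^ i * s" using Ni by (simp add: power2_eq_square)
  then have si: "s < 2 ^ i" using s by simp

  obtain P where P: "P \<subseteq> C \<times> diffset C C"
    and Pcard: "card C ^ (D + 2) \<le> card P * card (diffset (C + C) (C + C)) ^ D"
    and Pin: "\<And>a x. (a, x) \<in> P \<Longrightarrow> a + x \<in> C"
    and Pprog: "\<And>a x b y e. (a, x) \<in> P \<Longrightarrow> (b, y) \<in> P \<Longrightarrow> e \<le> D + 1 \<Longrightarrow>
       (a - b) + real e * (x - y) \<in> diffset C C"
    by (rule many_progressions_in_diffset[OF C Cne, of D]) blast
  have finP: "finite P" using P C finite_diffset finite_subset finite_cartesian_product by metis
  have P8: "s ^ 8 \<le> real (card P) * K ^ D"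
  proof -
    have "(s ^ 4) ^ (D + 2) \<le> real (card P) * M ^ D"
      using Pcard s(2) unfolding M_def by (metis of_nat_le_iff of_nat_mult of_nat_power)
    also have "\<dots> \<le> real (card P) * (K * s ^ 4) ^ D"
      using E unfolding M_def by (intro mult_left_mono power_mono) auto
    finally have "s ^ 8 * (s ^ 4) ^ D \<le> (real (card P) * K ^ D) * (s ^ 4) ^ D"
      by (simp add: power_add power_mult_distrib mult_ac flip: power_mult)
    then show ?thesis using s by simp
  qed
  define P' where "P' = {p \<in> P. card P \<le> 2 * card (snd ` P) * card {q \<in> P. snd q = snd p}}"
  have PP': "card P \<le> 2 * card P'" unfolding P'_def by (rule card_rich_lines[OF finP])
  have P'P: "P' \<subseteq> P" by (auto simp: P'_def)

  \<comment> \<open>Otherwise a pair would be determined by a and the cell of a + x, leaving at most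
    2 s^6 pairs in P' against at least s^8 / (2 K^D). The collision is sought in P' so that its step
    x is rich.\<close>
  have "\<exists>a x b y. (a, x) \<in> P' \<and> (b, y) \<in> P' \<and> cell i a = cell i b
      \<and> cell i (a + x) = cell i (b + y) \<and> x \<noteq> y"
  proof (rule ccontr)
    assume no: "\<not> ?thesis"
    have "card P' \<le> card (C \<times> cell i ` C)"
    proof (rule card_inj_on_le[of "\<lambda>(a, x). (a, cell i (a + x))"])
      show "inj_on (\<lambda>(a, x). (a, cell i (a + x))) P'"
        using no by (intro inj_onI) auto
      show "(\<lambda>(a, x). (a, cell i (a + x))) ` P' \<subseteq> C \<times> cell i ` C"
        using P P'P Pin by auto
    qed (use C in auto)
    then have "real (card P') \<le> s ^ 4 * N i"
      unfolding card_cartesian_product N_def s(2) [symmetric] by (metis of_nat_le_iff of_nat_mult)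
    also have "\<dots> \<le> s ^ 4 * (2 * s\<^sup>2)" using Ni2 s by (intro mult_left_mono) auto
    also have "\<dots> = 2 * s ^ 6" using pw(2) by simp
    finally have "real (card P) \<le> 4 * s ^ 6" using PP' by linarith
    then have "real (card P) * K ^ D \<le> (4 * s ^ 6) * K ^ D" using K by (intro mult_right_mono) auto
    then have "s ^ 6 * s\<^sup>2 \<le> s ^ 6 * (4 * K ^ D)" using P8 pw(3) by (simp add: mult_ac)
    then have "s\<^sup>2 \<le> 4 * K ^ D" by (rule mult_left_le_imp_le) (use s in simp)
    then show False using big by simp
  qed
  then obtain a x b y where ab: "(a, x) \<in> P'" "(b, y) \<in> P'" "cell i a = cell i b"
    "cell i (a + x) = cell i (b + y)" "x \<noteq> y" by blast
  define u where "u = x - y"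
  have "\<bar>u\<bar> \<le> \<bar>(a + x) - (b + y)\<bar> + \<bar>a - b\<bar>" unfolding u_def by linarith
  then have "2 ^ i * \<bar>u\<bar> \<le> 2 ^ i * (\<bar>(a + x) - (b + y)\<bar> + \<bar>a - b\<bar>)" by (intro mult_left_mono) auto
  then have iu: "2 ^ i * \<bar>u\<bar> < 2"
    using cell_eq_dist[OF ab(3)] cell_eq_dist[OF ab(4)] by (simp add: distrib_left)
  have "s * \<bar>u\<bar> \<le> 2 ^ i * \<bar>u\<bar>" using si by (intro mult_right_mono) auto
  then have us: "\<bar>u\<bar> < 2 / s" using iu s by (simp add: field_simps)

  \<comment> \<open>Richness of x gives A at least s^4 / (2 K^(D + 1)) elements.\<close>
  define A where "A = fst ` {q \<in> P. snd q = x}"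
  have AP: "(a', x) \<in> P" if "a' \<in> A" for a' using that by (auto simp: A_def)
  have AC: "A \<subseteq> C" using AP P by blast
  have finA: "finite A" using AC C finite_subset by blast
  have Ane: "A \<noteq> {}" using ab(1) P'P by (force simp: A_def)
  have cA: "card {q \<in> P. snd q = x} = card A"
    unfolding A_def by (rule card_image [symmetric]) (auto simp: inj_on_def)
  have "diffset C C \<subseteq> diffset (C + C) (C + C)"
  proof
    fix d assume "d \<in> diffset C C"
    then obtain p q where d: "p \<in> C" "q \<in> C" "d = (p + c0) - (q + c0)" by (auto simp: diffset_def)
    show "d \<in> diffset (C + C) (C + C)" unfolding d(3) by (intro diffsetI set_plus_intro d c0)
  qed
  then have "snd ` P \<subseteq> diffset (C + C) (C + C)" using P by auto
  then have "real (card (snd ` P)) \<le> M" using card_mono[OF finE] by (simp add: M_def)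
  then have sndP: "real (card (snd ` P)) \<le> K * s ^ 4" using E by (simp add: M_def)
  have A4: "s ^ 4 \<le> 2 * K ^ (D + 1) * real (card A)"
  proof -
    have "card P \<le> 2 * card (snd ` P) * card A" using ab(1) cA by (simp add: P'_def)
    then have "real (card P) \<le> 2 * real (card (snd ` P)) * real (card A)"
      by (metis of_nat_le_iff of_nat_mult of_nat_numeral)
    also have "\<dots> \<le> 2 * (K * s ^ 4) * real (card A)"
      using sndP by (intro mult_right_mono mult_left_mono) auto
    finally have "real (card P) * K ^ D \<le> 2 * (K * s ^ 4) * real (card A) * K ^ D"
      using K by (intro mult_right_mono) auto
    then have "s ^ 4 * s ^ 4 \<le> s ^ 4 * (2 * K ^ (D + 1) * real (card A))"
      using P8 pw(4) by (simp add: mult_ac)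
    then show ?thesis by (rule mult_left_le_imp_le) (use s in simp)
  qed
  have "card (C + C) \<le> card (diffset (C + C) (C + C))"
  proof (rule card_translate_le[OF finE])
    fix d assume "d \<in> C + C"
    then have "d - (c0 + c0) \<in> diffset (C + C) (C + C)" by (intro diffsetI set_plus_intro c0)
    then show "d + - (c0 + c0) \<in> diffset (C + C) (C + C)" by simp
  qed
  then have CC: "real (card (C + C)) \<le> K * s ^ 4" using E by simp
  define W where "W = real (card (cell i ` A))"
  \<comment> \<open>C meets at least s^2 cells at scale i, so by \<open>cell_mass_le\<close> none of
    them carries more than 2 K s^2 points; this forces A to spread over many cells.\<close>
  have cells: "real (card A) \<le> W * (2 * K * s\<^sup>2)"
  proof -
    have each: "real (card {c \<in> A. cell i c = v}) \<le> 2 * K * s\<^sup>2" for v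
    proof -
      have "card {c \<in> A. cell i c = v} \<le> card {c \<in> C. cell i c = v}"
        using AC C by (intro card_mono) auto
      then have "real (card {c \<in> A. cell i c = v}) * N i \<le> real (card {c \<in> C. cell i c = v}) * N i"
        by (intro mult_right_mono) (auto simp: N_def)
      also have "\<dots> \<le> 2 * real (card (C + C))"
        using cell_mass_le[OF C, of i v] unfolding N_def by (metis of_nat_le_iff of_nat_mult of_nat_numeral)
      also have "\<dots> \<le> 2 * K * s\<^sup>2 * s\<^sup>2" using CC pw(1) by (simp add: mult_ac)
      also have "\<dots> \<le> 2 * K * s\<^sup>2 * N i" using Ni K by (intro mult_left_mono) auto
      finally show ?thesis using Ni \<open>s\<^sup>2 > 1\<close> by simp
    qed
    have "real (card A) = (\<Sum>v\<in>cell i ` A. real (card {c \<in> A. cell i c = v}))"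
      using sum.group[of A "cell i ` A" "cell i" "\<lambda>_. 1::real"] finA by simp
    also have "\<dots> \<le> (\<Sum>v\<in>cell i ` A. 2 * K * s\<^sup>2)" by (intro sum_mono each)
    finally show ?thesis by (simp add: W_def)
  qed
  have W2: "s\<^sup>2 \<le> 4 * K ^ (D + 2) * W"
  proof -
    have "s ^ 4 \<le> 2 * K ^ (D + 1) * (W * (2 * K * s\<^sup>2))"
      using cells K by (intro order_trans[OF A4] mult_left_mono) auto
    then have "s\<^sup>2 * s\<^sup>2 \<le> s\<^sup>2 * (4 * K ^ (D + 2) * W)" using pw(1) by (simp add: mult_ac)
    then show ?thesis by (rule mult_left_le_imp_le) (use s in simp)
  qed

  \<comment> \<open>Congruence modulo 2 L + 1 leaves gaps of more than 2 L cell lengths, and |u| is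
    below two cell lengths. Restricting to a single unit interval costs the factor s.\<close>
  have L1: "1 \<le> 2 * L + 1" by simp
  obtain B where B: "B \<subseteq> A"
    "card (cell i ` A) \<le> card B * (card ((\<lambda>v. v div 2 ^ i) ` cell i ` A) * (2 * L + 1))"
    "\<And>a b. a \<in> B \<Longrightarrow> b \<in> B \<Longrightarrow> cell i a div 2 ^ i = cell i b div 2 ^ i"
    "\<And>a b. a \<in> B \<Longrightarrow> b \<in> B \<Longrightarrow> a \<noteq> b \<Longrightarrow> 2 ^ i * \<bar>a - b\<bar> > real (2 * L + 1) - 1"
    by (rule select_separated[OF finA Ane L1, of i "\<lambda>v. v div 2 ^ i"]) (rule that)
  have div0: "cell i c div 2 ^ i = cell 0 c" for c using cell_div[of 0 i c] by simp
  have "card (cell 0 ` A) \<le> card (cell 0 ` C)" using AC C by (intro card_mono) auto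
  then have small: "real (card (cell 0 ` A)) \<le> s" using few by simp
  have "card (cell i ` A) \<le> card B * (card (cell 0 ` A) * (2 * L + 1))"
    using B(2) by (simp add: image_image div0)
  then have "W \<le> real (card B * (card (cell 0 ` A) * (2 * L + 1)))"
    unfolding W_def by (simp only: of_nat_le_iff)
  also have "\<dots> = real (card B) * (real (card (cell 0 ` A)) * (2 * real L + 1))" by (simp add: distrib_left)
  also have "\<dots> \<le> real (card B) * (s * (2 * real L + 1))"
    using small by (intro mult_left_mono mult_right_mono) auto
  finally have "4 * K ^ (D + 2) * W \<le> 4 * K ^ (D + 2) * (real (card B) * (s * (2 * real L + 1)))"
    using K by (intro mult_left_mono) auto
  then have "s * s \<le> s * (real (card B) * (4 * K ^ (D + 2) * (2 * real L + 1)))"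
    using W2 by (simp add: power2_eq_square mult_ac)
  then have Bbig: "s \<le> real (card B) * (4 * K ^ (D + 2) * (2 * real L + 1))" using s by simp

  show thesis
  proof (rule that[of u "(\<lambda>a. a - b) ` B"])
    show "u \<noteq> 0" "\<bar>u\<bar> < 2 / s" using ab us by (auto simp: u_def)
    show "finite ((\<lambda>a. a - b) ` B)" using B(1) finA finite_subset by blast
    have "card ((\<lambda>a. a - b) ` B) = card B" by (intro card_image) (auto simp: inj_on_def)
    then show "s \<le> real (card ((\<lambda>a. a - b) ` B)) * (4 * K ^ (D + 2) * (2 * L + 1))"
      using Bbig by (simp add: add.commute)
    show "t + real e * u \<in> diffset C C" if "t \<in> (\<lambda>a. a - b) ` B" "e \<le> D + 1" for t e
    proof -
      obtain a' where "a' \<in> B" "t = a' - b" using \<open>t \<in> _\<close> by auto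
      then show ?thesis using Pprog[of a' x b y e] AP B(1) ab(2) P'P that(2) unfolding u_def by auto
    qed
    show "\<bar>t - t'\<bar> < 1" if "t \<in> (\<lambda>a. a - b) ` B" "t' \<in> (\<lambda>a. a - b) ` B" for t t'
    proof -
      obtain a' b' where "a' \<in> B" "t = a' - b" "b' \<in> B" "t' = b' - b"
        using \<open>t \<in> _\<close> \<open>t' \<in> _\<close> by auto
      then show ?thesis using B(3)[of a' b'] cell_eq_dist[of 0 a' b'] by (simp add: div0)
    qed
    show "\<bar>t - t'\<bar> > real L * \<bar>u\<bar>"
      if "t \<in> (\<lambda>a. a - b) ` B" "t' \<in> (\<lambda>a. a - b) ` B" "t \<noteq> t'" for t t'
    proof -
      obtain a' b' where a'b': "a' \<in> B" "t = a' - b" "b' \<in> B" "t' = b' - b"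
        using \<open>t \<in> _\<close> \<open>t' \<in> _\<close> by auto
      then have "2 ^ i * \<bar>t - t'\<bar> > 2 * real L" using B(4)[of a' b'] \<open>t \<noteq> t'\<close> by simp
      moreover have "real L * (2 ^ i * \<bar>u\<bar>) \<le> real L * 2" using iu by (intro mult_left_mono) auto
      ultimately have "2 ^ i * (real L * \<bar>u\<bar>) < 2 ^ i * \<bar>t - t'\<bar>"
        unfolding mult.left_commute[of "2 ^ i" "real L"] by linarith
      then show ?thesis by (rule mult_left_less_imp_less) simp
    qed
  qed
qed

section \<open>Sumsets of product sets\<close>

text \<open>Transfers spacing and diameter from B to its exponentials. Both carry the factor exp
  \<beta>, so the position of B on the line cancels when they are compared; the 2 comes from e <=
  3.\<close>

lemma exp_separation:
  fixes B :: "real set"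
  assumes "B \<subseteq> {\<beta>..<\<beta> + 1}" and b: "b \<in> B" "b' \<in> B"
  shows "exp \<beta> * \<bar>b - b'\<bar> \<le> \<bar>exp b - exp b'\<bar>" "\<bar>exp b - exp b'\<bar> \<le> 2 * exp \<beta>"
proof -
  have \<beta>: "\<beta> \<le> x" and diam: "x < \<beta> + 1" if "x \<in> B" for x using assms(1) that by auto
  have *: "exp \<beta> * \<bar>x - y\<bar> \<le> \<bar>exp x - exp y\<bar>" if "\<beta> \<le> y" "y \<le> x" for x y
  proof -
    have "x - y \<le> exp (x - y) - 1" using exp_ge_add_one_self[of "x - y"] by linarith
    then have "exp \<beta> * (x - y) \<le> exp y * (exp (x - y) - 1)"
      using that by (intro mult_mono) auto
    also have "\<dots> = exp x - exp y" by (simp add: right_diff_distrib flip: exp_add)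
    finally show ?thesis using that by simp
  qed
  show "exp \<beta> * \<bar>b - b'\<bar> \<le> \<bar>exp b - exp b'\<bar>"
    using *[of b' b] *[of b b'] \<beta> b by (cases "b \<le> b'") (auto simp: abs_minus_commute)
  have "exp \<beta> \<le> exp x \<and> exp x \<le> 3 * exp \<beta>" if "x \<in> B" for x
  proof -
    have "exp x \<le> exp (\<beta> + 1)" using diam[OF that] by simp
    also have "\<dots> \<le> exp \<beta> * 3" unfolding exp_add using exp_le by (intro mult_left_mono) auto
    finally show ?thesis using \<beta>[OF that] by simp
  qed
  from this[OF b(1)] this[OF b(2)] show "\<bar>exp b - exp b'\<bar> \<le> 2 * exp \<beta>" by linarith
qed

text \<open>The numbers r, D and c are fixed before C, s and K, which later allows the range of
  \<epsilon> to be chosen before the set A. The condition K^D <= c s makes the base at least 1, so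
  that in the lacunary case the exponent may be raised from r to h.\<close>

lemma hfold_sumset_exp_diffset_ge:
  assumes k: "k \<ge> 1" "3 * k ^ 3 \<le> h"
  obtains r D :: nat and c :: real where "3 * (k + 1) \<le> 8 * r" "c > 0"
    "\<And>(C :: real set) s K. finite C \<Longrightarrow> s > 0 \<Longrightarrow> real (card C) = s ^ 4 \<Longrightarrow> K \<ge> 1 \<Longrightarrow>
       real (card (diffset (C + C) (C + C))) \<le> K * s ^ 4 \<Longrightarrow> K ^ D \<le> c * s \<Longrightarrow>
       (c * s / K ^ D) ^ r \<le> (real (card (hfold_sumset h (exp ` diffset C C))))\<^sup>2"
proof -
  define T where "T = {..<3 * k} \<times> {..<k}"
  have T: "finite T" "card T = 3 * k * k" by (auto simp: T_def)
  obtain S where S: "S \<subseteq> {1..k}" "3 * (k + 1) \<le> 8 * card S"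
    and gaps: "\<And>\<sigma>. \<sigma> \<in> S \<Longrightarrow> \<exists>e e'. first_power_sum_gap T \<sigma> e e'"
    by (rule many_first_power_sum_gaps[OF k(1), folded T_def]) (rule that)
  have finS: "finite S" using S finite_subset by auto
  have cS: "card S \<le> k" using card_mono[OF _ S(1)] by simp
  obtain e e' where gap: "\<And>\<sigma>. \<sigma> \<in> S \<Longrightarrow> first_power_sum_gap T \<sigma> (e \<sigma>) (e' \<sigma>)"
    using gaps by metis
  obtain \<eta> M :: real where \<eta>: "\<eta> > 0" and M: "M \<ge> 0"
    and nz: "\<And>u \<sigma>. 0 < \<bar>u\<bar> \<Longrightarrow> \<bar>u\<bar> < \<eta> \<Longrightarrow> \<sigma> \<in> S \<Longrightarrow> exp_gap T (e \<sigma>) (e' \<sigma>) u \<noteq> 0"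
    and tail: "\<And>u \<sigma>. 0 < \<bar>u\<bar> \<Longrightarrow> \<bar>u\<bar> < \<eta> \<Longrightarrow> \<sigma> \<in> S \<Longrightarrow>
      (\<Sum>\<tau> | \<tau> \<in> S \<and> \<sigma> < \<tau>. \<bar>exp_gap T (e \<tau>) (e' \<tau>) u\<bar>) \<le> M * \<bar>u\<bar> * \<bar>exp_gap T (e \<sigma>) (e' \<sigma>) u\<bar>"
    by (rule exp_gap_dominates_tail[OF finS gap]) (assumption, rule that)
  \<comment> \<open>A crude upper bound for all exponents in all chosen pairs, so the progressions
    reach every multiple of u that occurs.\<close>
  define D where "D = (\<Sum>\<sigma>\<in>S. \<Sum>i\<in>T. e \<sigma> i + e' \<sigma> i)"
  have De: "e \<sigma> i \<le> D + 1 \<and> e' \<sigma> i \<le> D + 1" if "\<sigma> \<in> S" "i \<in> T" for \<sigma> i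
  proof -
    have "e \<sigma> i + e' \<sigma> i \<le> (\<Sum>i\<in>T. e \<sigma> i + e' \<sigma> i)"
      using that T by (intro member_le_sum) auto
    also have "\<dots> \<le> D" unfolding D_def using that finS by (intro member_le_sum[of \<sigma>]) auto
    finally show ?thesis by simp
  qed
  \<comment> \<open>The exponentials of B have gaps above exp \<beta> L |u| and diameter at most 2
    exp \<beta>, while the tail ratio is M |u|; L >= 2 M is what the digit argument demands.\<close>
  define L where "L = nat \<lceil>2 * M\<rceil>"
  have L: "2 * M \<le> real L" unfolding L_def by linarith
  \<comment> \<open>Together with c s >= 1, the three terms give the lower bound for |B|, the
    inequality 2 / s <= \<eta> that puts u inside the radius, and 2 h <= s for the lacunary
    case.\<close>
  define c where "c = min (min (1 / (4 * (2 * real L + 1))) (\<eta> / 2)) (1 / (2 * real h))"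
  have h: "h \<ge> 1" "k \<le> h"
  proof -
    have "k \<le> k ^ 3" using k(1) by (simp add: self_le_power)
    then show "k \<le> h" using k(2) by linarith
    then show "h \<ge> 1" using k(1) by linarith
  qed
  have c: "c > 0" "c \<le> 1 / (4 * (2 * real L + 1))" "c \<le> \<eta> / 2" "c \<le> 1 / (2 * real h)"
    using \<eta> h unfolding c_def by auto
  show thesis
  proof (rule that[OF S(2) c(1), of "D + 2"])
    fix C :: "real set" and s K :: real
    assume C: "finite C" and s: "s > 0" "real (card C) = s ^ 4" and K: "K \<ge> 1"
      and E: "real (card (diffset (C + C) (C + C))) \<le> K * s ^ 4" and Ks: "K ^ (D + 2) \<le> c * s"
    let ?X = "exp ` diffset C C"
    have finX: "finite ?X" using C by (intro finite_imageI finite_diffset)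
    have K1: "K ^ j \<ge> 1" for j using K by simp
    then have cs1: "1 \<le> c * s" using Ks K1[of "D + 2"] by linarith
    have base: "1 \<le> c * s / K ^ (D + 2)" using Ks K by simp
    show "(c * s / K ^ (D + 2)) ^ card S \<le> (real (card (hfold_sumset h ?X)))\<^sup>2"
    proof (cases "real (card (cell 0 ` C)) < s")
      case False
      have "c * s \<le> 1 / (2 * real h) * s" using c(4) s by (intro mult_right_mono) auto
      then have cs: "c * s \<le> s / (2 * real h)" by simp
      then have "1 \<le> s / (2 * real h)" using cs1 by linarith
      then have "2 * real h \<le> s" using h by (simp add: field_simps)
      then have N: "2 * h \<le> card (cell 0 ` C)" using False by linarith
      have div_le: "c * s / K ^ (D + 2) \<le> c * s"
        using cs1 K1[of "D + 2"] divide_left_mono[of 1 "K ^ (D + 2)" "c * s"] by simp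
      have "(c * s / K ^ (D + 2)) ^ card S \<le> (c * s / K ^ (D + 2)) ^ h"
        using base cS h by (intro power_increasing) auto
      also have "\<dots> \<le> (c * s) ^ h"
        using base by (intro power_mono div_le) linarith
      also have "\<dots> \<le> (real (card (cell 0 ` C)) / (2 * real h)) ^ h"
      proof (rule power_mono)
        have "s / (2 * real h) \<le> real (card (cell 0 ` C)) / (2 * real h)"
          using False by (intro divide_right_mono) auto
        then show "c * s \<le> real (card (cell 0 ` C)) / (2 * real h)" using cs by linarith
      qed (use cs1 in simp)
      also have "\<dots> \<le> real (card (hfold_sumset h ?X))"
        by (rule many_cells_imp_large_sumset[OF C h(1) N])
      also have "\<dots> \<le> real (card (hfold_sumset h ?X) ^ 2)"
        by (intro of_nat_mono) (simp add: power2_eq_square)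
      finally show ?thesis by simp
    next
      case True
      have "c * s \<le> 1 / (4 * (2 * real L + 1)) * s" using c s by (intro mult_right_mono) auto
      also have "\<dots> \<le> 1 / 4 * s" using s by (intro mult_right_mono) (auto simp: field_simps)
      finally have s4: "4 * K ^ (D + 2) \<le> s" using Ks by simp
      then have "s > 1" using K1[of "D + 2"] by linarith
      have "4 * K ^ D \<le> 4 * K ^ (D + 2)" using K by (intro mult_left_mono power_increasing) auto
      also note s4
      also have "s < s\<^sup>2" using \<open>s > 1\<close> by (simp add: power2_eq_square)
      finally have big: "s\<^sup>2 > 4 * K ^ D" .
      obtain B u where u: "u \<noteq> 0" "\<bar>u\<bar> < 2 / s" and B: "finite B"
        "s \<le> real (card B) * (4 * K ^ (D + 2) * (2 * L + 1))"
        and Bprog: "\<And>b e. b \<in> B \<Longrightarrow> e \<le> D + 1 \<Longrightarrow> b + real e * u \<in> diffset C C"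
        and Bdiam: "\<And>b b'. b \<in> B \<Longrightarrow> b' \<in> B \<Longrightarrow> \<bar>b - b'\<bar> < 1"
        and Bsep: "\<And>b b'. b \<in> B \<Longrightarrow> b' \<in> B \<Longrightarrow> b \<noteq> b' \<Longrightarrow> \<bar>b - b'\<bar> > real L * \<bar>u\<bar>"
        by (rule spaced_progressions[OF C s K E True big, of L]) (rule that)
      have "2 / s \<le> \<eta>"
      proof -
        have "1 \<le> \<eta> / 2 * s" using cs1 c(3) s by (meson mult_right_mono order_trans less_imp_le)
        then show ?thesis using s by (simp add: field_simps)
      qed
      then have u\<eta>: "0 < \<bar>u\<bar>" "\<bar>u\<bar> < \<eta>" using u by auto
      have Bne: "B \<noteq> {}" using B s by auto
      define \<beta> where "\<beta> = Min B"
      have \<beta>: "\<beta> \<in> B" "\<And>b. b \<in> B \<Longrightarrow> \<beta> \<le> b" using B Bne by (auto simp: \<beta>_def)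
      have "b < \<beta> + 1" if "b \<in> B" for b using Bdiam[OF that \<beta>(1)] by simp
      then have "B \<subseteq> {\<beta>..<\<beta> + 1}" using \<beta> by auto
      note exps = exp_separation[OF this]
      have "real (card (exp ` B) ^ card S) \<le> real ((card (hfold_sumset (card S * card T) ?X))\<^sup>2)"
      proof (intro of_nat_mono card_power_le_hfold_sumset_square[OF finS T(1) finX])
        show "\<bar>a - b\<bar> \<le> 2 * exp \<beta>" if "a \<in> exp ` B" "b \<in> exp ` B" for a b
          using that exps(2) by auto
        show "\<bar>a - b\<bar> > 2 * exp \<beta> * (M * \<bar>u\<bar>)" if ab: "a \<in> exp ` B" "b \<in> exp ` B" "a \<noteq> b" for a b
        proof -
          obtain x y where xy: "x \<in> B" "y \<in> B" "a = exp x" "b = exp y" "x \<noteq> y" using ab by auto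
          have "2 * exp \<beta> * (M * \<bar>u\<bar>) = exp \<beta> * (2 * M * \<bar>u\<bar>)" by simp
          also have "\<dots> \<le> exp \<beta> * (real L * \<bar>u\<bar>)" using L by (intro mult_left_mono mult_right_mono) auto
          also have "\<dots> < exp \<beta> * \<bar>x - y\<bar>" using Bsep[OF xy(1,2,5)] by simp
          also have "\<dots> \<le> \<bar>a - b\<bar>" using exps(1)[OF xy(1,2)] xy by simp
          finally show ?thesis .
        qed
        show "exp_gap T (e \<sigma>) (e' \<sigma>) u \<noteq> 0" if "\<sigma> \<in> S" for \<sigma> by (rule nz[OF u\<eta> that])
        show "(\<Sum>\<tau> | \<tau> \<in> S \<and> \<sigma> < \<tau>. \<bar>exp_gap T (e \<tau>) (e' \<tau>) u\<bar>) \<le> M * \<bar>u\<bar> * \<bar>exp_gap T (e \<sigma>) (e' \<sigma>) u\<bar>"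
          if "\<sigma> \<in> S" for \<sigma> by (rule tail[OF u\<eta> that])
        show "a * exp (real (e \<sigma> i) * u) \<in> ?X \<and> a * exp (real (e' \<sigma> i) * u) \<in> ?X"
          if "a \<in> exp ` B" "\<sigma> \<in> S" "i \<in> T" for a \<sigma> i
        proof -
          obtain b where "b \<in> B" "a = exp b" using \<open>a \<in> exp ` B\<close> by auto
          then show ?thesis
            using Bprog De[OF that(2,3)] by (auto simp flip: exp_add)
        qed
      qed
      also have "card (exp ` B) = card B" by (intro card_image) (auto simp: inj_on_def)
      also have "real ((card (hfold_sumset (card S * card T) ?X))\<^sup>2) \<le> real ((card (hfold_sumset h ?X))\<^sup>2)"
      proof (intro of_nat_mono power_mono card_hfold_sumset_mono finX)
        have "card S * card T \<le> k * (3 * k * k)" using cS T by (intro mult_le_mono) auto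
        also have "\<dots> \<le> h" using k(2) by (simp add: power3_eq_cube mult_ac)
        finally show "card S * card T \<le> h" .
        show "?X \<noteq> {}" using Bprog[OF \<beta>(1), of 0] by auto
      qed simp
      finally have fin: "real (card B) ^ card S \<le> (real (card (hfold_sumset h ?X)))\<^sup>2" by simp
      have "c * s / K ^ (D + 2) \<le> real (card B)"
      proof -
        have "c * s \<le> 1 / (4 * (2 * real L + 1)) * (real (card B) * (4 * K ^ (D + 2) * (2 * L + 1)))"
          using c(1,2) B(2) s by (intro mult_mono) auto
        also have "\<dots> = real (card B) * K ^ (D + 2) * ((4 * (2 * real L + 1)) / (4 * (2 * real L + 1)))"
          by (simp add: mult_ac add.commute)
        also have "\<dots> = real (card B) * K ^ (D + 2)" by (subst divide_self) auto
        finally show ?thesis using K by (simp add: pos_divide_le_eq)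
      qed
      then have "(c * s / K ^ (D + 2)) ^ card S \<le> real (card B) ^ card S"
        using base by (intro power_mono) auto
      then show ?thesis using fin by linarith
    qed
  qed
qed


text \<open>If \<open>x\<^sub>0\<close> is a popular sum of \<open>G\<close> and \<open>C = G \<inter> (x\<^sub>0 - G)\<close>, then \<open>x\<^sub>0 + (C - C) \<subseteq> G + G\<close>:
  this is what turns differences back into sums.\<close>

lemma popular_sum_reduction:
  fixes A :: "real set"
  assumes A: "finite A" "card A \<ge> 3"
  obtains C :: "real set" where "finite C" "C \<noteq> {}"
    "\<And>h. card (hfold_sumset h (exp ` diffset C C)) \<le> card (hfold_sumset h (A * A))"
    "(card A)\<^sup>2 \<le> 9 * card (A * A) * card C"
    "card (diffset (C + C) (C + C)) * card A ^ 3 \<le> 27 * card (A * A) ^ 4"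
    "card A \<le> 3 * card (A * A)"
proof -
  have finAA: "finite (A * A)" using A by (intro finite_set_times)
  \<comment> \<open>Logarithms need a constant sign. Zero costs one element, and as |A| >= 3 one
    sign class contains at least a third of A; products of two negative numbers are positive, so
    either class will do.\<close>
  define pos neg where "pos = {a \<in> A. a > 0}" and "neg = {a \<in> A. a < 0}"
  have "A \<subseteq> (pos \<union> neg) \<union> {0}" by (auto simp: pos_def neg_def)
  then have "card A \<le> card ((pos \<union> neg) \<union> {0})"
    using A by (intro card_mono) (auto simp: pos_def neg_def)
  also have "\<dots> \<le> card pos + card neg + 1"
    using card_Un_le[of "pos \<union> neg" "{0}"] card_Un_le[of pos neg] by simp
  finally have "card A \<le> 3 * card pos \<or> card A \<le> 3 * card neg" using A(2) by linarith
  moreover have "pos \<subseteq> A" "neg \<subseteq> A" by (auto simp: pos_def neg_def)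
  ultimately obtain A' where A': "A' \<subseteq> A" "card A \<le> 3 * card A'" "A' = pos \<or> A' = neg"
    by blast
  have same: "a * b > 0" if "a \<in> A'" "b \<in> A'" for a b
    using A'(3) that by (auto simp: pos_def neg_def zero_less_mult_iff)
  define G where "G = (\<lambda>a. ln \<bar>a\<bar>) ` A'"
  have finA': "finite A'" using A' A finite_subset by blast
  then have finG: "finite G" by (simp add: G_def)
  have "inj_on (\<lambda>a. ln \<bar>a\<bar>) A'"
    using A'(3) by (auto simp: inj_on_def pos_def neg_def)
  then have cG: "card G = card A'" unfolding G_def by (rule card_image)
  have Gne: "G \<noteq> {}" using cG A' A(2) by auto
  have expGG: "exp (g + g') \<in> A * A" if g: "g \<in> G" "g' \<in> G" for g g'
  proof -
    obtain a b where ab: "a \<in> A'" "b \<in> A'" "g = ln \<bar>a\<bar>" "g' = ln \<bar>b\<bar>" using g by (auto simp: G_def)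
    have "a \<noteq> 0" "b \<noteq> 0" using same[of a a] same[of b b] ab by auto
    then have "exp (g + g') = \<bar>a * b\<bar>" using ab by (simp add: exp_add abs_mult)
    also have "\<dots> = a * b" using same[OF ab(1,2)] by simp
    finally show ?thesis using ab A'(1) by (auto intro: set_times_intro)
  qed
  have finGG: "finite (G + G)" using finG by (intro finite_set_plus)
  have GG: "card (G + G) \<le> card (A * A)"
  proof (rule card_inj_on_le[OF _ _ finAA, of exp])
    show "exp ` (G + G) \<subseteq> A * A" using expGG by (auto elim!: set_plus_elim)
  qed (auto simp: inj_on_def)
  obtain x0 where x0: "x0 \<in> G + G"
    "card (G \<times> G) \<le> card {p \<in> G \<times> G. fst p + snd p = x0} * card (G + G)"
  proof (rule pigeonhole_fiber[of "G \<times> G" "G + G" "\<lambda>p. fst p + snd p"])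
    show "(\<lambda>p. fst p + snd p) ` (G \<times> G) \<subseteq> G + G" by auto
    show "G + G \<noteq> {}" using Gne by (auto simp: set_plus_def)
  qed (use finG finGG in auto)
  define C where "C = fst ` {p \<in> G \<times> G. fst p + snd p = x0}"
  have CG: "C \<subseteq> G" "\<And>c. c \<in> C \<Longrightarrow> x0 - c \<in> G" by (auto simp: C_def)
  have cC: "card C = card {p \<in> G \<times> G. fst p + snd p = x0}"
    unfolding C_def by (rule card_image) (auto simp: inj_on_def)
  have "card G * card G \<le> card C * card (G + G)"
    using x0(2) cC by (simp add: card_cartesian_product)
  then have CG2: "card G * card G \<le> card C * card (A * A)"
    using GG by (meson mult_le_mono2 order_trans)
  have finC: "finite C" using CG finG finite_subset by blast
  have Cne: "C \<noteq> {}" using CG2 Gne finG by (auto simp: card_gt_0_iff)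
  show thesis
  proof (rule that[OF finC Cne])
    fix h
    have "(\<lambda>x. exp x0 * x) ` (exp ` diffset C C) \<subseteq> A * A"
    proof (clarsimp simp: diffset_def)
      fix c c' assume "c \<in> C" "c' \<in> C"
      then have "exp (c + (x0 - c')) \<in> A * A" using CG by (intro expGG) auto
      then show "exp x0 * exp (c - c') \<in> A * A" by (simp add: algebra_simps flip: exp_add)
    qed
    then have "card (hfold_sumset h ((\<lambda>x. exp x0 * x) ` (exp ` diffset C C))) \<le> card (hfold_sumset h (A * A))"
      using finAA by (intro card_mono finite_hfold_sumset hfold_sumset_mono)
    then show "card (hfold_sumset h (exp ` diffset C C)) \<le> card (hfold_sumset h (A * A))"
      by (simp add: card_hfold_sumset_scale)
  next
    have "(card A)\<^sup>2 \<le> (3 * card G)\<^sup>2" using A'(2) cG by (intro power_mono) auto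
    also have "\<dots> \<le> 9 * (card C * card (A * A))" using CG2 by (simp add: power2_eq_square)
    finally show "(card A)\<^sup>2 \<le> 9 * card (A * A) * card C" by (simp add: mult_ac)
    have "card (diffset (C + C) (C + C)) \<le> card (diffset (G + G) (G + G))"
      using CG finGG by (intro card_mono finite_diffset diffset_mono set_plus_mono2)
    then have "card (diffset (C + C) (C + C)) * card A ^ 3
        \<le> card (diffset (G + G) (G + G)) * (3 * card G) ^ 3"
      using A'(2) cG by (intro mult_le_mono power_mono) auto
    also have "\<dots> = 27 * (card (diffset (G + G) (G + G)) * card G ^ 3)"
      by (simp add: power_mult_distrib)
    also have "\<dots> \<le> 27 * card (G + G) ^ 4"
      by (intro mult_le_mono2 card_double_diffset_le finG Gne)
    also have "\<dots> \<le> 27 * card (A * A) ^ 4" using GG by (intro mult_le_mono2 power_mono) auto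
    finally show "card (diffset (C + C) (C + C)) * card A ^ 3 \<le> 27 * card (A * A) ^ 4" .
    \<comment> \<open>The crude bound recorded here settles h = 2 at the end.\<close>
    obtain g where "g \<in> G" using Gne by blast
    then have "card G \<le> card (G + G)" by (intro card_translate_le[OF finGG, of _ g]) auto
    then show "card A \<le> 3 * card (A * A)" using A'(2) cG GG by linarith
  qed
qed

section \<open>Choice of parameters and conclusion\<close>

text \<open>From n^(1/4) <= 2 t s with t = n^\<epsilon>, the exponent 1/4 is spent as 1/8 + 1/16 +
  1/16: one sixteenth pays for the constant \<open>\<Gamma>\<close> because n is large, the other
  for t^(5D + 1) because \<epsilon> is small, and n^(1/8) <= c s / K^D remains. The r-th power and a
  square root give n^(r/16), where r >= 3(k + 1)/8.\<close>

lemma hfold_product_set_ge: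
  assumes k: "k \<ge> 1" "3 * k ^ 3 \<le> h"
  obtains \<epsilon>\<^sub>0 :: real where "\<epsilon>\<^sub>0 > 0"
    "\<And>\<epsilon>. 0 < \<epsilon> \<Longrightarrow> \<epsilon> < \<epsilon>\<^sub>0 \<Longrightarrow> \<exists>n\<^sub>0. \<forall>A :: real set. finite A \<and> card A > n\<^sub>0 \<and>
      real (card (A * A)) \<le> real (card A) powr (1 + \<epsilon>) \<longrightarrow>
      real (card A) powr (3 * real (k + 1) / 128) \<le> real (card (hfold_sumset h (A * A)))"
proof -
  obtain r D :: nat and c :: real where r: "3 * (k + 1) \<le> 8 * r" and c: "c > 0"
    and core: "\<And>(C :: real set) s K. finite C \<Longrightarrow> s > 0 \<Longrightarrow> real (card C) = s ^ 4 \<Longrightarrow> K \<ge> 1 \<Longrightarrow>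
       real (card (diffset (C + C) (C + C))) \<le> K * s ^ 4 \<Longrightarrow> K ^ D \<le> c * s \<Longrightarrow>
       (c * s / K ^ D) ^ r \<le> (real (card (hfold_sumset h (exp ` diffset C C))))\<^sup>2"
    by (rule hfold_sumset_exp_diffset_ge[OF k]) (rule that)
  define \<Gamma> where "\<Gamma> = 2 * 243 ^ D / c"
  have \<Gamma>: "\<Gamma> > 0" using c by (simp add: \<Gamma>_def)
  show thesis
  \<comment> \<open>In 5 D + 1, the part 5 D comes from K^D with K a multiple of t^5, and the 1 from
    passing from n to s.\<close>
  proof (rule that[of "1 / (16 * real (5 * D + 1))"])
    fix \<epsilon> :: real assume \<epsilon>: "0 < \<epsilon>" "\<epsilon> < 1 / (16 * real (5 * D + 1))"
    show "\<exists>n\<^sub>0. \<forall>A :: real set. finite A \<and> card A > n\<^sub>0 \<and>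
      real (card (A * A)) \<le> real (card A) powr (1 + \<epsilon>) \<longrightarrow>
      real (card A) powr (3 * real (k + 1) / 128) \<le> real (card (hfold_sumset h (A * A)))"
    proof (intro exI[of _ "nat \<lceil>\<Gamma> ^ 16\<rceil> + 3"] allI impI, elim conjE)
      fix A :: "real set"
      assume A: "finite A" and big: "card A > nat \<lceil>\<Gamma> ^ 16\<rceil> + 3"
        and small: "real (card (A * A)) \<le> real (card A) powr (1 + \<epsilon>)"
      define n where "n = real (card A)"
      define t where "t = n powr \<epsilon>"
      define p where "p = real (card (A * A))"
      have n3: "card A \<ge> 3" using big by simp
      then have n: "n \<ge> 3" by (simp add: n_def)
      have t1: "t \<ge> 1" using n \<epsilon> by (simp add: t_def ge_one_powr_ge_zero)
      have p: "p \<le> n * t" using small n by (simp add: p_def n_def t_def powr_add)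
      have "\<Gamma> ^ 16 \<le> real (nat \<lceil>\<Gamma> ^ 16\<rceil>)" by linarith
      also have "\<dots> \<le> n" using big by (simp add: n_def)
      also have "n = (n powr (1 / 16)) ^ 16" using n by (simp flip: powr_realpow add: powr_powr)
      finally have \<Gamma>n: "\<Gamma> \<le> n powr (1 / 16)" by (rule power_le_imp_le_base[of _ 15, simplified]) simp
      have "t ^ (5 * D + 1) = n powr (\<epsilon> * real (5 * D + 1))"
        using n unfolding t_def powr_powr [symmetric] by (subst powr_realpow) auto
      also have "\<dots> \<le> n powr (1 / 16)"
      proof (rule powr_mono)
        have "\<epsilon> * (16 * real (5 * D + 1)) < 1"
          using \<epsilon>(2) by (subst (asm) pos_less_divide_eq) auto
        then show "\<epsilon> * real (5 * D + 1) \<le> 1 / 16" by (simp add: algebra_simps)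
      qed (use n in simp)
      finally have tn: "t ^ (5 * D + 1) \<le> n powr (1 / 16)" .

      obtain C :: "real set" where C: "finite C" "C \<noteq> {}"
        and Ch: "\<And>h. card (hfold_sumset h (exp ` diffset C C)) \<le> card (hfold_sumset h (A * A))"
        and Cm: "(card A)\<^sup>2 \<le> 9 * card (A * A) * card C"
        and CE: "card (diffset (C + C) (C + C)) * card A ^ 3 \<le> 27 * card (A * A) ^ 4"
        by (rule popular_sum_reduction[OF A n3]) (rule that)
      define m where "m = real (card C)"
      define E where "E = real (card (diffset (C + C) (C + C)))"
      have m0: "m > 0" using C by (simp add: m_def card_gt_0_iff)
      have "n\<^sup>2 \<le> 9 * p * m"
        using of_nat_mono[OF Cm, where 'a = real] by (simp add: n_def p_def m_def)
      also have "\<dots> \<le> 9 * (n * t) * m" using p m0 by (intro mult_right_mono mult_left_mono) auto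
      finally have nm: "n \<le> 9 * t * m" using n by (simp add: power2_eq_square)
      have "E * n ^ 3 \<le> 27 * p ^ 4"
        using of_nat_mono[OF CE, where 'a = real] by (simp add: n_def p_def E_def)
      also have "\<dots> \<le> 27 * (n * t) ^ 4" using p by (intro mult_left_mono power_mono) (auto simp: p_def)
      finally have "E * n ^ 3 \<le> 27 * n * t ^ 4 * n ^ 3"
        by (simp add: power_mult_distrib power4_eq_xxxx power3_eq_cube mult_ac)
      then have "E \<le> 27 * n * t ^ 4" using n by simp
      also have "\<dots> \<le> 27 * (9 * t * m) * t ^ 4" using nm t1 by (intro mult_right_mono mult_left_mono) auto
      also have "\<dots> = 243 * t ^ 5 * m" by (simp add: eval_nat_numeral mult_ac)
      finally have E: "E \<le> 243 * t ^ 5 * m" .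
      define s where "s = m powr (1 / 4)"
      have s0: "s > 0" using m0 by (simp add: s_def)
      have s4: "s ^ 4 = m" using m0 by (simp add: s_def powr_powr flip: powr_realpow)
      have "(n powr (1 / 4)) ^ 4 = n" using n by (simp add: powr_powr flip: powr_realpow)
      also have "n \<le> 9 * t * m" by (rule nm)
      \<comment> \<open>Rounded up to a fourth power, so that a fourth root can be taken.\<close>
      also have "\<dots> \<le> 16 * t ^ 4 * m"
        using t1 m0 power_increasing[of 1 4 t] by (intro mult_right_mono mult_mono) auto
      also have "\<dots> = (2 * t * s) ^ 4" by (simp add: power_mult_distrib s4)
      finally have sn: "n powr (1 / 4) \<le> 2 * t * s"
        by (rule power_le_imp_le_base[of _ 3, simplified]) (use t1 s0 in simp)
      \<comment> \<open>243 = 27 * 9: the bound 27 n t^4 for 2C - 2C combined with n <= 9 t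
        |C|.\<close>
      define K where "K = 243 * t ^ 5"
      have "t ^ 5 \<ge> 1" using t1 by simp
      then have K: "K \<ge> 1" by (simp add: K_def)
      have "n powr (1 / 8) * n powr (1 / 16) * n powr (1 / 16) = n powr (1 / 4)"
        by (simp flip: powr_add)
      moreover have "n powr (1 / 8) * \<Gamma> * t ^ (5 * D + 1) \<le> n powr (1 / 8) * n powr (1 / 16) * n powr (1 / 16)"
        using \<Gamma>n tn \<Gamma> t1 by (intro mult_mono[OF mult_left_mono]) auto
      ultimately have "n powr (1 / 8) * \<Gamma> * t ^ (5 * D + 1) \<le> n powr (1 / 4)" by simp
      also note sn
      finally have "n powr (1 / 8) * \<Gamma> * t ^ (5 * D) \<le> 2 * s" using t1 by (simp add: mult_ac)
      then have "n powr (1 / 8) * (c * \<Gamma>) * t ^ (5 * D) \<le> 2 * (c * s)"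
        using c by (simp add: mult_ac)
      then have "n powr (1 / 8) * (243 ^ D * t ^ (5 * D)) \<le> c * s" using c by (simp add: \<Gamma>_def mult_ac)
      then have nK: "n powr (1 / 8) * K ^ D \<le> c * s"
        by (simp add: K_def power_mult_distrib flip: power_mult)
      have n8: "n powr (1 / 8) \<ge> 1" using n by (simp add: ge_one_powr_ge_zero)
      have KD: "K ^ D \<ge> 1" using K by simp
      have "1 * K ^ D \<le> n powr (1 / 8) * K ^ D" using n8 KD by (intro mult_right_mono) auto
      then have "K ^ D \<le> c * s" using nK by simp
      define H where "H = real (card (hfold_sumset h (A * A)))"
      have "n powr (1 / 8) \<le> c * s / K ^ D" using nK KD by (simp add: pos_le_divide_eq)
      then have "(n powr (1 / 8)) ^ r \<le> (c * s / K ^ D) ^ r" by (intro power_mono) auto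
      also have "\<dots> \<le> (real (card (hfold_sumset h (exp ` diffset C C))))\<^sup>2"
        using C s0 s4 K E \<open>K ^ D \<le> c * s\<close> by (intro core) (auto simp: m_def E_def K_def)
      also have "\<dots> \<le> H\<^sup>2" unfolding H_def using Ch by (intro power_mono) auto
      also have "(n powr (1 / 8)) ^ r = (n powr (real r / 16))\<^sup>2"
        using n by (simp add: powr_powr flip: powr_realpow)
      finally have "n powr (real r / 16) \<le> H" by (rule power2_le_imp_le) (simp add: H_def)
      moreover have "n powr (3 * real (k + 1) / 128) \<le> n powr (real r / 16)"
      proof (rule powr_mono)
        have "3 * real (k + 1) \<le> 8 * real r" using r by linarith
        then show "3 * real (k + 1) / 128 \<le> real r / 16" by simp
      qed (use n in simp)
      ultimately show "real (card A) powr (3 * real (k + 1) / 128) \<le> real (card (hfold_sumset h (A * A)))"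
        by (simp add: n_def H_def)
    qed
  qed simp
qed

text \<open>The denominator enters through ln h >= 1/2, so h / ln h <= 2 h <= 6 (k + 1)^3, and 6 <=
  2^3.\<close>

lemma exponent_bound:
  assumes h: "h \<ge> 2" and hk: "h < 3 * (k + 1) ^ 3"
  shows "(real h / ln (real h)) powr (1 / 3) \<le> 2 * real (k + 1)"
proof -
  have "exp (1 / 2) \<le> (2 :: real)"
  proof (rule power2_le_imp_le)
    show "(exp (1 / 2 :: real))\<^sup>2 \<le> 2\<^sup>2" using exp_le by (simp flip: exp_of_nat_mult)
  qed simp
  then have "1 / 2 \<le> ln (2 :: real)" by (subst ln_ge_iff) auto
  also have "\<dots> \<le> ln (real h)" using h by simp
  finally have "1 / 2 \<le> ln (real h)" .
  then have "real h / ln (real h) \<le> real h / (1 / 2)" using h by (intro divide_left_mono) auto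
  also have "\<dots> \<le> 2 * (3 * real (k + 1) ^ 3)"
  proof -
    have "real h \<le> real (3 * (k + 1) ^ 3)" using hk by (intro of_nat_mono) simp
    then show ?thesis by simp
  qed
  also have "\<dots> \<le> (2 * real (k + 1)) ^ 3" unfolding power_mult_distrib by simp
  finally have "(real h / ln (real h)) powr (1 / 3) \<le> ((2 * real (k + 1)) ^ 3) powr (1 / 3)"
    using h by (intro powr_mono2) auto
  also have "\<dots> = (2 * real (k + 1)) powr (real 3 * (1 / 3))"
    unfolding powr_powr [symmetric] by (subst powr_realpow) auto
  also have "\<dots> = 2 * real (k + 1)" by simp
  finally show ?thesis .
qed

theorem theorem2:
  shows "\<exists>c::real. c > 0 \<and>
    (\<forall>h::nat. h \<ge> 2 \<longrightarrow>
      (\<exists>\<epsilon>\<^sub>0::real. \<epsilon>\<^sub>0 > 0 \<and>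
        (\<forall>\<epsilon>::real. 0 < \<epsilon> \<and> \<epsilon> < \<epsilon>\<^sub>0 \<longrightarrow>
          (\<exists>n\<^sub>0::nat. \<forall>n::nat. n > n\<^sub>0 \<longrightarrow>
            (\<forall>A::real set. finite A \<and> card A = n \<and>
                real (card (A * A)) \<le> real n powr (1 + \<epsilon>) \<longrightarrow>
              real (card (hfold_sumset h (A * A)))
                > real n powr (c * (real h / ln (real h)) powr (1 / 3)))))))"
proof (rule exI[of _ "1 / 100"], intro conjI allI impI)
  show "(0::real) < 1 / 100" by simp
  fix h :: nat assume h: "2 \<le> h"
  \<comment> \<open>The largest k with 3 k^3 <= h; it is 0 exactly for h = 2.\<close>
  define k where "k = (LEAST k. h < 3 * (k + 1) ^ 3)"
  have "h < 3 * (h + 1) ^ 3"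
    using self_le_power[of "h + 1" 3] by linarith
  then have hk: "h < 3 * (k + 1) ^ 3" unfolding k_def by (rule LeastI)
  have kh: "3 * k ^ 3 \<le> h"
    using not_less_Least[of "k - 1" "\<lambda>k. h < 3 * (k + 1) ^ 3"] unfolding k_def [symmetric]
    by (cases k) auto
  \<comment> \<open>With the factor 1/100 the exponent is at most (k + 1)/50, which lies strictly
    below 3(k + 1)/128; this margin gives the strict inequality.\<close>
  define \<theta> where "\<theta> = 1 / 100 * (real h / ln (real h)) powr (1 / 3)"
  have \<theta>: "\<theta> \<le> 1 / 50 * real (k + 1)"
    using exponent_bound[OF h hk] by (simp add: \<theta>_def)
  show "\<exists>\<epsilon>\<^sub>0::real. \<epsilon>\<^sub>0 > 0 \<and> (\<forall>\<epsilon>::real. 0 < \<epsilon> \<and> \<epsilon> < \<epsilon>\<^sub>0 \<longrightarrow>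
          (\<exists>n\<^sub>0::nat. \<forall>n::nat. n > n\<^sub>0 \<longrightarrow>
            (\<forall>A::real set. finite A \<and> card A = n \<and>
                real (card (A * A)) \<le> real n powr (1 + \<epsilon>) \<longrightarrow>
              real (card (hfold_sumset h (A * A)))
                > real n powr (1 / 100 * (real h / ln (real h)) powr (1 / 3)))))"
    unfolding \<theta>_def [symmetric]
  proof (cases "k \<ge> 1")
    case True
    obtain \<epsilon>\<^sub>0 :: real where \<epsilon>\<^sub>0: "\<epsilon>\<^sub>0 > 0"
      and main: "\<And>\<epsilon>. 0 < \<epsilon> \<Longrightarrow> \<epsilon> < \<epsilon>\<^sub>0 \<Longrightarrow> \<exists>n\<^sub>0. \<forall>A :: real set. finite A \<and> card A > n\<^sub>0 \<and>
        real (card (A * A)) \<le> real (card A) powr (1 + \<epsilon>) \<longrightarrow>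
        real (card A) powr (3 * real (k + 1) / 128) \<le> real (card (hfold_sumset h (A * A)))"
      by (rule hfold_product_set_ge[OF True kh]) (rule that)
    have less: "real n powr \<theta> < real n powr (3 * real (k + 1) / 128)" if "n > 1" for n :: nat
      using \<theta> that by (intro powr_less_mono) auto
    show "\<exists>\<epsilon>\<^sub>0::real. \<epsilon>\<^sub>0 > 0 \<and> (\<forall>\<epsilon>::real. 0 < \<epsilon> \<and> \<epsilon> < \<epsilon>\<^sub>0 \<longrightarrow>
      (\<exists>n\<^sub>0::nat. \<forall>n::nat. n > n\<^sub>0 \<longrightarrow> (\<forall>A::real set. finite A \<and> card A = n \<and>
          real (card (A * A)) \<le> real n powr (1 + \<epsilon>) \<longrightarrow>
        real (card (hfold_sumset h (A * A))) > real n powr \<theta>)))"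
    proof (intro exI[of _ \<epsilon>\<^sub>0] conjI allI impI \<epsilon>\<^sub>0, elim conjE)
      fix \<epsilon> :: real assume "0 < \<epsilon>" "\<epsilon> < \<epsilon>\<^sub>0"
      then obtain n\<^sub>0 where n\<^sub>0: "\<And>A :: real set. finite A \<Longrightarrow> card A > n\<^sub>0 \<Longrightarrow>
        real (card (A * A)) \<le> real (card A) powr (1 + \<epsilon>) \<Longrightarrow>
        real (card A) powr (3 * real (k + 1) / 128) \<le> real (card (hfold_sumset h (A * A)))"
        using main by blast
      show "\<exists>n\<^sub>0::nat. \<forall>n::nat. n > n\<^sub>0 \<longrightarrow> (\<forall>A::real set. finite A \<and> card A = n \<and>
          real (card (A * A)) \<le> real n powr (1 + \<epsilon>) \<longrightarrow>
        real (card (hfold_sumset h (A * A))) > real n powr \<theta>)"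
      proof (intro exI[of _ "n\<^sub>0 + 1"] allI impI, elim conjE)
        fix n :: nat and A :: "real set"
        assume "n > n\<^sub>0 + 1" "finite A" "card A = n" "real (card (A * A)) \<le> real n powr (1 + \<epsilon>)"
        then show "real (card (hfold_sumset h (A * A))) > real n powr \<theta>"
          using n\<^sub>0[of A] by (intro less_le_trans[OF less]) auto
      qed
    qed
  next
    \<comment> \<open>Here h = 2 and \<theta> <= 1/50. The bound |A A| >= n/3 beats sqrt n once n >
      9, for every \<epsilon>, so the values 1 and 9 suffice.\<close>
    case False
    then have "\<theta> \<le> 1 / 2" using \<theta> by simp
    have triv: "real n powr \<theta> < real (card (hfold_sumset h (A * A)))"
      if n: "n > 9" and A: "finite A" "card A = n" for n and A :: "real set"
    proof -
      have "card A \<ge> 3" using n A by simp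
      then have AA: "n \<le> 3 * card (A * A)"
        unfolding A(2) [symmetric] by (rule popular_sum_reduction[OF A(1)])
      have "hfold_sumset 1 (A * A) = A * A" by (simp add: hfold_sumset_def)
      moreover have "finite (A * A)" using A by (intro finite_set_times)
      moreover have "A * A \<noteq> {}" using AA n by auto
      ultimately have "card (A * A) \<le> card (hfold_sumset h (A * A))"
        using card_hfold_sumset_mono[of 1 h "A * A"] h by simp
      then have "real n \<le> 3 * real (card (hfold_sumset h (A * A)))" using AA by linarith
      moreover have "3 * real n powr \<theta> < real n"
      proof -
        have "real n powr \<theta> \<le> sqrt (real n)"
          using \<open>\<theta> \<le> 1 / 2\<close> n by (simp add: powr_mono flip: powr_half_sqrt)
        moreover have "3 < sqrt (real n)" using n by (intro real_less_rsqrt) auto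
        then have "3 * sqrt (real n) < sqrt (real n) * sqrt (real n)"
          using n by (intro mult_strict_right_mono) auto
        ultimately show ?thesis by simp
      qed
      ultimately show ?thesis by linarith
    qed
    show "\<exists>\<epsilon>\<^sub>0::real. \<epsilon>\<^sub>0 > 0 \<and> (\<forall>\<epsilon>::real. 0 < \<epsilon> \<and> \<epsilon> < \<epsilon>\<^sub>0 \<longrightarrow>
      (\<exists>n\<^sub>0::nat. \<forall>n::nat. n > n\<^sub>0 \<longrightarrow> (\<forall>A::real set. finite A \<and> card A = n \<and>
          real (card (A * A)) \<le> real n powr (1 + \<epsilon>) \<longrightarrow>
        real (card (hfold_sumset h (A * A))) > real n powr \<theta>)))"
      using triv by (intro exI[of _ 1]) (auto intro!: exI[of _ 9])
  qed
qed

end
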